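(* The category $\Delta D$ makes the family $\{D_{n+1}\}_{n\ge0}$ of dihedral groups into a crossed simplicial group, where $D_n$ denotes the dihedral group of order $2n$. That is, $\Delta D$ contains $\Delta$ as a subcategory and: (1) for every $n\ge0$, $\operatorname{Aut}_{\Delta D}([n]_{\mathrm{cyc}})$ is isomorphic to $D_{n+1}^{\mathrm{op}}$; (2) every morphism $[m]_{\mathrm{cyc}}\to[n]_{\mathrm{cyc}}$ in $\Delta D$ can be uniquely written as a composite $\phi\circ g$ with $\phi\in\operatorname{Hom}_\Delta([m],[n])$ and $g\in\operatorname{Aut}_{\Delta D}([m]_{\mathrm{cyc}})$.
   Context: **Crossed simplicial groups.** Let $\Delta$ be the category of the ordered sets $[n]=\{0<\dots<n\}$, $n\ge0$, and order-preserving maps. A crossed simplicial group is a family of groups $\{G_n\}_{n\ge0}$ together with a category $\Delta G$ that has one object $[n]$ for each $n\ge0$, contains $\Delta$ as a subcategory, and satisfies: (1) $\operatorname{Aut}_{\Delta G}[n]$ is isomorphic to $G_n^{\mathrm{op}}$; (2) every morphism $[m]\to[n]$ can be uniquely written as $\phi\circ g$ with $\phi\in\operatorname{Hom}_\Delta([m],[n])$ and $g\in\operatorname{Aut}_{\Delta G}[m]$. **$\mathbb{Z}_+$-categories.** Let $\mathbb{Z}_+$ be the additive monoid of non-negative integers. A $\mathbb{Z}_+$-category is a category with a non-identity endomorphism $1_c:c\to c$ on each object $c$ such that $f\circ1_{c_1}=1_{c_2}\circ f$ for all $f:c_1\to c_2$. A (covariant) $\mathbb{Z}_+$-functor is a functor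 preserving these endomorphisms. $\mathcal{C}^{\mathrm{op}}$ is a $\mathbb{Z}_+$-category with $1_c=(1_c)^{\mathrm{op}}$; a contravariant $\mathbb{Z}_+$-functor $\mathcal{C}\to\mathcal{D}$ is a $\mathbb{Z}_+$-functor $\mathcal{C}\to\mathcal{D}^{\mathrm{op}}$. The circle $\mathbb{R}/\mathbb{Z}$ is a $\mathbb{Z}_+$-category: objects are points; morphisms $x\to y$ are homotopy classes of paths from $x$ to $y$ of the form $[0,1]\to\mathbb{R}\to\mathbb{R}/\mathbb{Z}$, the first map continuous non-decreasing and the second the projection; $1_x$ is the class of degree 1 loops at $x$. $[n]_{\mathrm{cyc}}$ is the full $\mathbb{Z}_+$-subcategory of $\mathbb{R}/\mathbb{Z}$ on the points $0,\frac1{n+1},\dots,\frac n{n+1}$. Equivalently, its objects are $0,\dots,n$ and its morphisms are generated by those of the linearly ordered set $[n]$ together with one new generator $n\to0$, with $1_i:i\to n\to0\to i$. **$\Delta D$.** The objects of $\Delta D$ are the $[n]_{\mathrm{cyc}}$, $n\ge0$. The set of morphisms from $[m]_{\mathrm{cyc}}$ to $[n]_{\mathrm{cyc}}$ is the disjoint union of the sets of covariant and of contravariant $\mathbb{Z}_+$-functors from $[m]_{\mathrm{cyc}}$ to $[n]_{\mathrm{cyc}}$ (so no functor counts as both). Composition is composition of functors, the composite of two covariant or two contravariant functors being covariant and the composite of a covariant and a contravariant functor being contravariant. $\Delta$ is regarded as a subcategory by sending $[n]$ to $[n]_{\mathrm{cyc}}$ and an order-preserving map $f$ to the covariant $\mathbb{Z}_+$-functor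 $f_{\mathrm{cyc}}:[m]_{\mathrm{cyc}}\to[n]_{\mathrm{cyc}}$ which extends $f$ and sends the generator $m\to0$ to the composite $f(m)\to n\to0\to f(0)$. *)

theory Defs
  imports "HOL-Analysis.Analysis" "HOL-Algebra.Group"
begin

section \<open>Categories and functors\<close>

record ('o, 'm) cat =
  Obj :: "'o set"
  Arr :: "'m set"
  Dom :: "'m \<Rightarrow> 'o"
  Cod :: "'m \<Rightarrow> 'o"
  Idt :: "'o \<Rightarrow> 'm"
  Comp :: "'m \<Rightarrow> 'm \<Rightarrow> 'm"

text \<open>\<open>Comp C g f\<close> is the composite of \<open>f\<close> followed by \<open>g\<close>.\<close>

definition Hom :: "('o, 'm, 'x) cat_scheme \<Rightarrow> 'o \<Rightarrow> 'o \<Rightarrow> 'm set" where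
  "Hom C x y = {f \<in> Arr C. Dom C f = x \<and> Cod C f = y}"

locale category =
  fixes C :: "('o, 'm, 'x) cat_scheme"
  assumes dom_in: "f \<in> Arr C \<Longrightarrow> Dom C f \<in> Obj C"
    and cod_in: "f \<in> Arr C \<Longrightarrow> Cod C f \<in> Obj C"
    and idt_in: "x \<in> Obj C \<Longrightarrow> Idt C x \<in> Hom C x x"
    and comp_in: "f \<in> Hom C x y \<Longrightarrow> g \<in> Hom C y z \<Longrightarrow> Comp C g f \<in> Hom C x z"
    and idt_left: "f \<in> Hom C x y \<Longrightarrow> Comp C (Idt C y) f = f"
    and idt_right: "f \<in> Hom C x y \<Longrightarrow> Comp C f (Idt C x) = f"
    and comp_assoc: "f \<in> Hom C w x \<Longrightarrow> g \<in> Hom C x y \<Longrightarrow> h \<in> Hom C y z \<Longrightarrow>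
      Comp C (Comp C h g) f = Comp C h (Comp C g f)"

text \<open>The object and arrow maps of a functor are required to be \<open>undefined\<close> outside the
  source category, so that two functors are equal iff they agree on all objects and arrows.\<close>

record ('o, 'm, 'p, 'n) ftor =
  on_obj :: "'o \<Rightarrow> 'p"
  on_arr :: "'m \<Rightarrow> 'n"

locale cat_functor = source: category C + target: category D
  for C :: "('o, 'm, 'x) cat_scheme" and D :: "('p, 'n, 'y) cat_scheme" +
  fixes F :: "('o, 'm, 'p, 'n) ftor"
  assumes on_obj_in: "on_obj F \<in> Obj C \<rightarrow>\<^sub>E Obj D"
    and on_arr_ext: "on_arr F \<in> extensional (Arr C)"
    and on_arr_in: "f \<in> Hom C x y \<Longrightarrow> on_arr F f \<in> Hom D (on_obj F x) (on_obj F y)"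
    and map_idt: "x \<in> Obj C \<Longrightarrow> on_arr F (Idt C x) = Idt D (on_obj F x)"
    and map_comp: "f \<in> Hom C x y \<Longrightarrow> g \<in> Hom C y z \<Longrightarrow>
      on_arr F (Comp C g f) = Comp D (on_arr F g) (on_arr F f)"

definition functor_id :: "('o, 'm, 'x) cat_scheme \<Rightarrow> ('o, 'm, 'o, 'm) ftor" where
  "functor_id C = \<lparr>on_obj = (\<lambda>x\<in>Obj C. x), on_arr = (\<lambda>f\<in>Arr C. f)\<rparr>"

text \<open>\<open>functor_comp C G F\<close> is \<open>G\<close> after \<open>F\<close>, where \<open>C\<close> is the source of \<open>F\<close>.\<close>

definition functor_comp ::
    "('o, 'm, 'x) cat_scheme \<Rightarrow> ('p, 'n, 'q, 'l) ftor \<Rightarrow> ('o, 'm, 'p, 'n) ftor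
      \<Rightarrow> ('o, 'm, 'q, 'l) ftor" where
  "functor_comp C G F =
    \<lparr>on_obj = compose (Obj C) (on_obj G) (on_obj F),
     on_arr = compose (Arr C) (on_arr G) (on_arr F)\<rparr>"

definition aut_group :: "('o, 'm, 'x) cat_scheme \<Rightarrow> 'o \<Rightarrow> 'm monoid" where
  "aut_group C x = units_of \<lparr>carrier = Hom C x x, mult = Comp C, one = Idt C x\<rparr>"


section \<open>$\mathbb{Z}_+$-categories\<close>

text \<open>\<open>Loop C c\<close> is the distinguished endomorphism $1_c$.\<close>

record ('o, 'm) zcat = "('o, 'm) cat" +
  Loop :: "'o \<Rightarrow> 'm"

locale zplus_category = category C
  for C :: "('o, 'm, 'x) zcat_scheme" +
  assumes loop_in: "c \<in> Obj C \<Longrightarrow> Loop C c \<in> Hom C c c"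
    and loop_not_idt: "c \<in> Obj C \<Longrightarrow> Loop C c \<noteq> Idt C c"
    and loop_natural: "f \<in> Hom C c d \<Longrightarrow> Comp C f (Loop C c) = Comp C (Loop C d) f"

locale zplus_functor =
  source: zplus_category C + target: zplus_category D + cat_functor C D F
  for C :: "('o, 'm, 'x) zcat_scheme" and D :: "('p, 'n, 'y) zcat_scheme"
    and F :: "('o, 'm, 'p, 'n) ftor" +
  assumes map_loop: "c \<in> Obj C \<Longrightarrow> on_arr F (Loop C c) = Loop D (on_obj F c)"

text \<open>The opposite category has the same arrows; in particular its distinguished endomorphisms
  are those of \<open>C\<close>, and composites of contravariant functors are computed by
  \<^const>\<open>functor_comp\<close>.\<close>

definition opposite :: "('o, 'm, 'x) cat_scheme \<Rightarrow> ('o, 'm, 'x) cat_scheme" where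
  "opposite C = C\<lparr>Dom := Cod C, Cod := Dom C, Comp := (\<lambda>g f. Comp C f g)\<rparr>"

definition full_subcategory :: "'o set \<Rightarrow> ('o, 'm, 'x) cat_scheme \<Rightarrow> ('o, 'm, 'x) cat_scheme" where
  "full_subcategory S C =
    C\<lparr>Obj := Obj C \<inter> S, Arr := {f \<in> Arr C. Dom C f \<in> S \<and> Cod C f \<in> S}\<rparr>"


section \<open>The circle $\mathbb{R}/\mathbb{Z}$\<close>

quotient_type circle = real / "\<lambda>s t :: real. s - t \<in> \<int>"
  morphisms rep_circle proj
proof (rule equivpI)
  show "reflp (\<lambda>s t :: real. s - t \<in> \<int>)"
    by (simp add: reflp_def)
  show "symp (\<lambda>s t :: real. s - t \<in> \<int>)"
    by (metis (no_types, lifting) Ints_minus minus_diff_eq sympI)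
  show "transp (\<lambda>s t :: real. s - t \<in> \<int>)"
    by (rule transpI) (metis Ints_add add.commute add_diff_eq diff_add_cancel)
qed

instantiation circle :: topological_space
begin

definition open_circle :: "circle set \<Rightarrow> bool" where
  "open_circle U \<longleftrightarrow> open (proj -` U)"

instance
proof
  show "open (UNIV :: circle set)"
    by (simp add: open_circle_def)
  show "open (S \<inter> T)" if "open S" "open T" for S T :: "circle set"
    using that by (simp add: open_circle_def open_Int)
  show "open (\<Union> K)" if "\<forall>S\<in>K. open S" for K :: "circle set set"
    using that by (auto simp: open_circle_def vimage_Union)
qed

end

text \<open>As for the library's paths, only the values on the unit interval matter: a path may be
  arbitrary elsewhere, and paths agreeing on the unit interval are homotopic.\<close>

definition mono_paths :: "circle \<Rightarrow> circle \<Rightarrow> (real \<Rightarrow> circle) set" where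
  "mono_paths x y = {p. pathstart p = x \<and> pathfinish p = y \<and>
    (\<exists>u :: real \<Rightarrow> real. path u \<and> mono_on {0..1} u \<and> (\<forall>s\<in>{0..1}. p s = proj (u s)))}"

definition homotopy_rel ::
    "circle \<Rightarrow> circle \<Rightarrow> ((real \<Rightarrow> circle) \<times> (real \<Rightarrow> circle)) set" where
  "homotopy_rel x y =
    {(p, q). p \<in> mono_paths x y \<and> q \<in> mono_paths x y \<and> homotopic_paths UNIV p q}"

definition degree_one_loops :: "circle \<Rightarrow> (real \<Rightarrow> circle) set" where
  "degree_one_loops x = {p \<in> mono_paths x x.
    \<exists>u :: real \<Rightarrow> real. path u \<and> mono_on {0..1} u \<and> (\<forall>s\<in>{0..1}. p s = proj (u s)) \<and>
      u 1 = u 0 + 1}"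

text \<open>An arrow is a triple of its source, a homotopy class of paths, and its target.\<close>

type_synonym circle_arrow = "circle \<times> (real \<Rightarrow> circle) set \<times> circle"

definition circle_cat :: "(circle, circle_arrow) zcat" where
  "circle_cat =
    \<lparr>Obj = UNIV,
     Arr = {(x, P, y). P \<in> mono_paths x y // homotopy_rel x y},
     Dom = (\<lambda>(x, P, y). x),
     Cod = (\<lambda>(x, P, y). y),
     Idt = (\<lambda>x. (x, homotopy_rel x x `` {\<lambda>_. x}, x)),
     Comp = (\<lambda>(y', Q, z) (x, P, y). (x, homotopy_rel x z `` {p +++ q | p q. p \<in> P \<and> q \<in> Q}, z)),
     Loop = (\<lambda>x. (x, degree_one_loops x, x))\<rparr>"


section \<open>The categories $[n]_{\mathrm{cyc}}$\<close>

definition cyc_point :: "nat \<Rightarrow> nat \<Rightarrow> circle" where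
  "cyc_point n i = proj (real i / real (n + 1))"

definition cyc :: "nat \<Rightarrow> (circle, circle_arrow) zcat" where
  "cyc n = full_subcategory (cyc_point n ` {0..n}) circle_cat"

definition segment_arrow :: "real \<Rightarrow> real \<Rightarrow> circle_arrow" where
  "segment_arrow a b =
    (proj a, homotopy_rel (proj a) (proj b) `` {proj \<circ> linepath a b}, proj b)"

text \<open>The arrow \<open>i \<rightarrow> j\<close> of the ordered set $[n]$, for $i \le j \le n$, and the additional
  generator \<open>n \<rightarrow> 0\<close>, as arrows of $[n]_{\mathrm{cyc}}$.\<close>

definition order_arrow :: "nat \<Rightarrow> nat \<Rightarrow> nat \<Rightarrow> circle_arrow" where
  "order_arrow n i j = segment_arrow (real i / real (n + 1)) (real j / real (n + 1))"

definition wrap_arrow :: "nat \<Rightarrow> circle_arrow" where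
  "wrap_arrow n = segment_arrow (real n / real (n + 1)) 1"


section \<open>The categories $\Delta$ and $\Delta D$\<close>

definition Delta :: "(nat, nat \<times> (nat \<Rightarrow> nat) \<times> nat) cat" where
  "Delta =
    \<lparr>Obj = UNIV,
     Arr = {(m, f, n). f \<in> {0..m} \<rightarrow>\<^sub>E {0..n} \<and> mono_on {0..m} f},
     Dom = (\<lambda>(m, f, n). m),
     Cod = (\<lambda>(m, f, n). n),
     Idt = (\<lambda>n. (n, \<lambda>i\<in>{0..n}. i, n)),
     Comp = (\<lambda>(m', g, n) (l, f, m). (l, compose {0..l} g f, n))\<rparr>"

type_synonym cyc_functor = "(circle, circle_arrow, circle, circle_arrow) ftor"

text \<open>The left summand consists of the covariant functors, the right one of the contravariant
  functors.\<close>

definition cyc_maps :: "nat \<Rightarrow> nat \<Rightarrow> (cyc_functor + cyc_functor) set" where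
  "cyc_maps m n =
    {F. zplus_functor (cyc m) (cyc n) F} <+> {F. zplus_functor (cyc m) (opposite (cyc n)) F}"

fun cyc_maps_comp ::
    "nat \<Rightarrow> cyc_functor + cyc_functor \<Rightarrow> cyc_functor + cyc_functor \<Rightarrow> cyc_functor + cyc_functor"
where
  "cyc_maps_comp l (Inl G) (Inl F) = Inl (functor_comp (cyc l) G F)"
| "cyc_maps_comp l (Inr G) (Inr F) = Inl (functor_comp (cyc l) G F)"
| "cyc_maps_comp l (Inl G) (Inr F) = Inr (functor_comp (cyc l) G F)"
| "cyc_maps_comp l (Inr G) (Inl F) = Inr (functor_comp (cyc l) G F)"

definition DeltaD :: "(nat, nat \<times> (cyc_functor + cyc_functor) \<times> nat) cat" where
  "DeltaD =
    \<lparr>Obj = UNIV,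
     Arr = {(m, T, n). T \<in> cyc_maps m n},
     Dom = (\<lambda>(m, T, n). m),
     Cod = (\<lambda>(m, T, n). n),
     Idt = (\<lambda>n. (n, Inl (functor_id (cyc n)), n)),
     Comp = (\<lambda>(m', S, n) (l, T, m). (l, cyc_maps_comp l S T, n))\<rparr>"

definition is_cyc_extension :: "nat \<Rightarrow> nat \<Rightarrow> (nat \<Rightarrow> nat) \<Rightarrow> cyc_functor \<Rightarrow> bool" where
  "is_cyc_extension m n f F \<longleftrightarrow>
    zplus_functor (cyc m) (cyc n) F \<and>
    (\<forall>i\<le>m. on_obj F (cyc_point m i) = cyc_point n (f i)) \<and>
    (\<forall>i j. i \<le> j \<and> j \<le> m \<longrightarrow> on_arr F (order_arrow m i j) = order_arrow n (f i) (f j)) \<and>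
    on_arr F (wrap_arrow m) =
      Comp (cyc n) (order_arrow n 0 (f 0)) (Comp (cyc n) (wrap_arrow n) (order_arrow n (f m) n))"

definition cyc_extension :: "nat \<Rightarrow> nat \<Rightarrow> (nat \<Rightarrow> nat) \<Rightarrow> cyc_functor" where
  "cyc_extension m n f = (THE F. is_cyc_extension m n f F)"

definition Delta_to_DeltaD ::
    "(nat, nat \<times> (nat \<Rightarrow> nat) \<times> nat, nat, nat \<times> (cyc_functor + cyc_functor) \<times> nat) ftor" where
  "Delta_to_DeltaD =
    \<lparr>on_obj = (\<lambda>n. n),
     on_arr = (\<lambda>(m, f, n)\<in>Arr Delta. (m, Inl (cyc_extension m n f), n))\<rparr>"


section \<open>Crossed simplicial groups\<close>

definition opposite_group :: "('a, 'b) monoid_scheme \<Rightarrow> ('a, 'b) monoid_scheme" where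
  "opposite_group G = G\<lparr>mult := (\<lambda>x y. y \<otimes>\<^bsub>G\<^esub> x)\<rparr>"

text \<open>The category \<open>C\<close> has one object for each natural number; \<open>I\<close> is the inclusion
  of the subcategory $\Delta$.\<close>

locale crossed_simplicial_group =
  category C + inclusion: cat_functor Delta C I
  for G :: "nat \<Rightarrow> ('a, 'b) monoid_scheme"
    and C :: "(nat, 'm, 'x) cat_scheme"
    and I :: "(nat, nat \<times> (nat \<Rightarrow> nat) \<times> nat, nat, 'm) ftor" +
  assumes groups: "group (G n)"
    and objects: "Obj C = UNIV"
    and inclusion_obj: "on_obj I n = n"
    and inclusion_inj: "inj_on (on_arr I) (Arr Delta)"
    and automorphisms: "aut_group C n \<cong> opposite_group (G n)"
    and unique_factorization: "h \<in> Hom C m n \<Longrightarrow>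
      \<exists>!(\<phi>, g). \<phi> \<in> Hom Delta m n \<and> g \<in> carrier (aut_group C m) \<and> h = Comp C (on_arr I \<phi>) g"

text \<open>The dihedral group of order $2n$, for $n \ge 1$, as the semidirect product of
  $\mathbb{Z}/n$ with the group of order two acting by negation. The pair \<open>(a, s)\<close> is rotation by
  \<open>a\<close> steps, preceded by the reflection if \<open>s\<close> holds. For \<open>n = 1, 2\<close> this is
  the group of order two and the Klein four-group.\<close>

definition dihedral_group :: "nat \<Rightarrow> (int \<times> bool) monoid" where
  "dihedral_group n =
    \<lparr>carrier = {0..<int n} \<times> UNIV,
     mult = (\<lambda>(a, s) (b, t). ((if s then a - b else a + b) mod int n, s \<noteq> t)),
     one = (0, False)\<rparr>"

end

theory Submission
  imports Defs
begin

text \<open>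
  Everything is reduced to maps of the integers. A monotone path in the circle lifts to a
  non-decreasing path in \<open>\<real>\<close>, and its homotopy class is determined by the two end points of
  the lift: paths in \<open>\<real>\<close> with common end points are homotopic along straight lines, and
  conversely the displacement of a lift is a homotopy invariant (monodromy of the exponential
  covering, \<open>mono_lift_displacement\<close>). So the arrows of the circle are intervals \<open>a \<le> b\<close> of real
  numbers modulo simultaneous translation by integers, composition is concatenation of
  intervals, and the degree one loop at \<open>a\<close> is the interval from \<open>a\<close> to \<open>a + 1\<close>.

  Rescaling by \<open>n + 1\<close>, the category on the points \<open>i/(n + 1)\<close> is the ordered set \<open>\<int>\<close>
  modulo translation by \<open>n + 1\<close>. A functor between two such categories that preserves the loops
  is therefore a map \<open>\<phi> : \<int> \<rightarrow> \<int>\<close>, unique up to adding multiples of \<open>n + 1\<close>, which is either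
  non-decreasing with \<open>\<phi> (k + m + 1) = \<phi> k + n + 1\<close> (covariant) or non-increasing with
  \<open>\<phi> (k + m + 1) = \<phi> k - (n + 1)\<close> (contravariant); composition of functors is composition of
  maps (\<open>zplus_functor_lift\<close>, \<open>Hom_DeltaD\<close>, \<open>dihedral_map_eq_iff\<close>, \<open>Comp_dihedral_map\<close>). A sign
  \<open>orient s = \<plusminus>1\<close> treats both variances at once.

  In this description the three claims are elementary. An order-preserving \<open>f : [m] \<rightarrow> [n]\<close>
  extends uniquely to a periodic map, and the maps so obtained are exactly those that send
  \<open>{0..m}\<close> into \<open>{0..n}\<close>. An invertible \<open>\<phi>\<close> has a left inverse up to translation, so it is injective and its steps are
  at least one in absolute value; as \<open>n + 1\<close> consecutive steps add up to \<open>n + 1\<close>, all of them are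
  one, and \<open>\<phi> k = a \<plusminus> k\<close>: these maps form the dihedral group (\<open>aut_group_DeltaD_iso\<close>). Finally, a
  covariant \<open>\<phi>\<close> crosses zero at exactly one \<open>a\<close>, in the sense that \<open>\<phi> (a - 1) < 0 \<le> \<phi> a\<close>, and
  \<open>k \<mapsto> \<phi> (a + k)\<close> is the only translate of \<open>\<phi>\<close> that comes from an order-preserving map; this
  is unique factorization (\<open>dihedral_map_factorization\<close>), the contravariant case following by
  precomposing with \<open>k \<mapsto> - k\<close>.
\<close>

section \<open>Homotopy classes of monotone paths in the circle\<close>

lemma proj_eq_iff: "proj s = proj t \<longleftrightarrow> s - t \<in> \<int>"
  by (rule circle.abs_eq_iff)

lemma proj_add_of_int [simp]: "proj (a + of_int k) = proj a"
  by (simp add: proj_eq_iff)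

lemma proj_eqE:
  assumes "proj s = proj t"
  obtains k where "s = t + of_int k"
  using assms by (metis Ints_cases add_diff_cancel_left' add.commute diff_add_cancel proj_eq_iff)

lemma proj_surj: obtains a where "x = proj a"
  by (metis Quotient3_abs_rep Quotient3_circle)

lemma continuous_on_proj: "continuous_on A proj"
proof -
  have "continuous_on UNIV proj"
    by (subst continuous_on_open_vimage) (auto simp: open_circle_def)
  then show ?thesis
    by (rule continuous_on_subset) simp
qed

text \<open>The embedding of the circle in the punctured complex plane. It transports homotopies from the
  quotient topology to a normed space, where the theory of covering spaces applies.\<close>

lift_definition circle_exp :: "circle \<Rightarrow> complex" is "\<lambda>t. exp (2 * of_real pi * \<i> * of_real t)"
proof -
  fix s t :: real
  assume "s - t \<in> \<int>"
  then obtain k where k: "s = t + of_int k"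
    by (metis Ints_cases add.commute diff_add_cancel)
  have "2 * of_real pi * \<i> * of_real s
      = 2 * of_real pi * \<i> * of_real t + of_int (2 * k) * (of_real pi * \<i>)"
    by (simp add: k algebra_simps)
  then show "exp (2 * of_real pi * \<i> * of_real s) = exp (2 * of_real pi * \<i> * of_real t)"
    by (auto simp: exp_eq)
qed

lemma circle_exp_proj: "circle_exp (proj t) = exp (2 * of_real pi * \<i> * of_real t)"
  by (rule circle_exp.abs_eq)

lemma continuous_on_circle_exp: "continuous_on A circle_exp"
proof -
  have "continuous_on UNIV circle_exp"
  proof (subst continuous_on_open_vimage)
    show "\<forall>B. open B \<longrightarrow> open (circle_exp -` B \<inter> UNIV)"
    proof (intro allI impI)
      fix B :: "complex set" assume B: "open B"
      have c: "continuous_on UNIV (\<lambda>t::real. exp (2 * of_real pi * \<i> * of_real t) :: complex)"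
        by (intro continuous_intros)
      have "proj -` (circle_exp -` B) = (\<lambda>t. exp (2 * of_real pi * \<i> * of_real t)) -` B"
        by (auto simp: circle_exp_proj)
      then show "open (circle_exp -` B \<inter> UNIV)"
        using open_vimage[OF B c] by (simp add: open_circle_def)
    qed
  qed simp
  then show ?thesis
    by (rule continuous_on_subset) simp
qed

definition mono_lift :: "(real \<Rightarrow> circle) \<Rightarrow> (real \<Rightarrow> real) \<Rightarrow> bool" where
  "mono_lift p u \<longleftrightarrow> path u \<and> mono_on {0..1} u \<and> (\<forall>s\<in>{0..1}. p s = proj (u s))"

lemma mono_paths_iff:
  "p \<in> mono_paths x y \<longleftrightarrow> pathstart p = x \<and> pathfinish p = y \<and> (\<exists>u. mono_lift p u)"
  by (simp add: mono_paths_def mono_lift_def)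

text \<open>After multiplication by \<open>2 * pi * \<i>\<close>, lifts to \<open>\<real>\<close> become lifts along the exponential map
  \<open>exp : \<complex> \<rightarrow> \<complex> - {0}\<close>, and the lifts of homotopic paths with the same start have the same end. The
  starts of \<open>u\<close> and \<open>v\<close> differ by an integer \<open>v 0 - u 0\<close>, which is subtracted from \<open>v\<close> first.\<close>

lemma mono_lift_displacement:
  assumes pq: "homotopic_paths UNIV p q" and u: "mono_lift p u" and v: "mono_lift q v"
  shows "v 1 - v 0 = u 1 - u 0"
proof -
  let ?c = "2 * of_real pi * \<i> :: complex"
  let ?d = "v 0 - u 0"
  have "p 0 = q 0"
    using homotopic_paths_imp_pathstart[OF pq] by (simp add: pathstart_def)
  then have "proj (v 0) = proj (u 0)"
    using u v by (simp add: mono_lift_def)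
  then have d: "proj (t - ?d) = proj t" for t
    by (metis add_diff_cancel_left' add_diff_cancel proj_eqE proj_add_of_int diff_add_cancel)
  have hom: "homotopic_paths (- {0}) (circle_exp \<circ> p) (circle_exp \<circ> q)"
  proof (rule homotopic_paths_continuous_image[OF pq continuous_on_circle_exp])
    show "circle_exp \<in> UNIV \<rightarrow> - {0}"
    proof
      fix x show "circle_exp x \<in> - {0}"
        by (cases x rule: proj_surj) (auto simp: circle_exp_proj)
    qed
  qed
  have lift: "exp (?c * of_real (u t)) = (circle_exp \<circ> p) t"
    "exp (?c * of_real (v t - ?d)) = (circle_exp \<circ> q) t" if "t \<in> {0..1}" for t
    using that u v d[of "v t"] by (simp_all only: mono_lift_def o_apply flip: circle_exp_proj)
  have paths: "path (\<lambda>t. ?c * of_real (u t))" "path (\<lambda>t. ?c * of_real (v t - ?d))"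
    using u v unfolding mono_lift_def path_def by (auto intro!: continuous_intros)
  have "pathfinish (\<lambda>t. ?c * of_real (u t)) = pathfinish (\<lambda>t. ?c * of_real (v t - ?d))"
    by (rule covering_space_monodromy[OF covering_space_exp_punctured_plane _ _ _ _ hom
          paths(1) _ lift(1) paths(2) _ lift(2)])
      (use homotopic_paths_imp_path[OF hom] homotopic_paths_imp_subset[OF hom]
        in \<open>auto simp: pathstart_def o_def\<close>)
  then have "?c * of_real (u 1) = ?c * of_real (v 1 - ?d)"
    by (simp add: pathfinish_def)
  then have "u 1 = v 1 - ?d"
    by (simp only: mult_cancel_left of_real_eq_iff) auto
  then show ?thesis
    by simp
qed

text \<open>For \<open>a \<le> b\<close> this is one homotopy class of monotone paths (\<open>homotopy_rel_path_class\<close>), indexed by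
  the end points of a lift.\<close>

definition path_class :: "real \<Rightarrow> real \<Rightarrow> (real \<Rightarrow> circle) set" where
  "path_class a b = {p. \<exists>u. mono_lift p u \<and> u 0 = a \<and> u 1 = b}"

lemma path_class_subset_mono_paths: "path_class a b \<subseteq> mono_paths (proj a) (proj b)"
  by (auto simp: path_class_def mono_paths_iff mono_lift_def pathstart_def pathfinish_def)

lemma path_class_le: "p \<in> path_class a b \<Longrightarrow> a \<le> b"
  by (auto simp: path_class_def mono_lift_def mono_on_def)

lemma path_class_shift: "path_class (a + of_int k) (b + of_int k) = path_class a b"
proof -
  have sub: "path_class a b \<subseteq> path_class (a + of_int k) (b + of_int k)" for a b k
  proof
    fix p assume "p \<in> path_class a b"
    then obtain u where "mono_lift p u" "u 0 = a" "u 1 = b"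
      by (auto simp: path_class_def)
    then show "p \<in> path_class (a + of_int k) (b + of_int k)"
      by (auto simp: path_class_def mono_lift_def path_def mono_on_def
          intro!: exI[of _ "\<lambda>s. u s + of_int k"] continuous_intros)
  qed
  have "path_class (a + of_int k) (b + of_int k)
      \<subseteq> path_class (a + of_int k + of_int (- k)) (b + of_int k + of_int (- k))"
    by (rule sub)
  with sub[of a b k] show ?thesis
    by (simp add: algebra_simps)
qed

lemma mono_paths_path_classE:
  assumes "p \<in> mono_paths (proj a) y"
  obtains b where "a \<le> b" "y = proj b" "p \<in> path_class a b"
proof -
  from assms obtain u where p: "pathstart p = proj a" "pathfinish p = y" and u: "mono_lift p u"
    by (auto simp: mono_paths_iff)
  have "proj a = proj (u 0)"
    using p u by (auto simp: mono_lift_def pathstart_def)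
  then obtain k where k: "a = u 0 + of_int k"
    by (rule proj_eqE)
  have "p \<in> path_class (u 0) (u 1)"
    using u by (auto simp: path_class_def)
  then have "p \<in> path_class a (u 1 + of_int k)"
    by (simp add: k path_class_shift)
  moreover have "y = proj (u 1 + of_int k)"
    using p u by (auto simp: mono_lift_def pathfinish_def)
  ultimately show thesis
    using that path_class_le by blast
qed

lemma homotopic_proj_mono_lift: "mono_lift p u \<Longrightarrow> homotopic_paths UNIV (proj \<circ> u) p"
  by (intro homotopic_paths_eq)
    (auto simp: mono_lift_def intro!: path_continuous_image continuous_on_proj)

lemma homotopic_in_path_class:
  assumes "p \<in> path_class a b" "q \<in> path_class a b"
  shows "homotopic_paths UNIV p q"
proof -
  obtain u v where u: "mono_lift p u" "u 0 = a" "u 1 = b" and v: "mono_lift q v" "v 0 = a" "v 1 = b"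
    using assms by (auto simp: path_class_def)
  have "homotopic_paths UNIV u v"
    using u v by (intro homotopic_paths_linear) (auto simp: mono_lift_def pathstart_def pathfinish_def)
  then have "homotopic_paths UNIV (proj \<circ> u) (proj \<circ> v)"
    by (rule homotopic_paths_continuous_image) (auto intro: continuous_on_proj)
  then show ?thesis
    using homotopic_proj_mono_lift[OF u(1)] homotopic_proj_mono_lift[OF v(1)]
    by (meson homotopic_paths_sym homotopic_paths_trans)
qed

text \<open>A homotopic monotone path has a lift starting at \<open>a\<close>, and the displacement of this lift is
  the one of \<open>p\<close>.\<close>

lemma homotopic_to_path_class:
  assumes p: "p \<in> path_class a b" and q: "q \<in> mono_paths x y" and pq: "homotopic_paths UNIV p q"
  shows "q \<in> path_class a b"
proof -
  have "q 0 = p 0"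
    using homotopic_paths_imp_pathstart[OF pq] by (simp add: pathstart_def)
  then have "pathstart q = proj a"
    using p by (auto simp: path_class_def mono_lift_def pathstart_def)
  then have "q \<in> mono_paths (proj a) y"
    using q by (auto simp: mono_paths_iff)
  then obtain b' where b': "q \<in> path_class a b'"
    by (rule mono_paths_path_classE)
  then have "b' = b"
    using p mono_lift_displacement[OF pq] by (fastforce simp: path_class_def)
  with b' show ?thesis by simp
qed

lemma homotopy_rel_path_class:
  assumes "p \<in> path_class a b"
  shows "homotopy_rel (proj a) (proj b) `` {p} = path_class a b"
  using homotopic_in_path_class[OF assms] homotopic_to_path_class[OF assms]
    path_class_subset_mono_paths[of a b] assms
  by (auto simp: homotopy_rel_def)

lemma linepath_in_path_class: "a \<le> b \<Longrightarrow> proj \<circ> linepath a b \<in> path_class a b"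
proof -
  assume "a \<le> b"
  then have "linepath a b s \<le> linepath a b t" if "s \<le> t" for s t
    using mult_right_mono[of s t "b - a"] that by (simp add: linepath_def algebra_simps)
  then have "mono_on {0..1} (linepath a b)"
    by (simp add: mono_on_def)
  then show ?thesis
    by (auto simp: path_class_def mono_lift_def linepath_def intro!: exI[of _ "linepath a b"])
qed

lemma path_class_join:
  assumes p: "p \<in> path_class a b" and q: "q \<in> path_class b c"
  shows "p +++ q \<in> path_class a c"
proof -
  obtain u v where u: "mono_lift p u" "u 0 = a" "u 1 = b" and v: "mono_lift q v" "v 0 = b" "v 1 = c"
    using assms by (auto simp: path_class_def)
  have ub: "u s \<le> b" if "s \<in> {0..1}" for s
    using u that by (auto simp: mono_lift_def mono_on_def)
  have vb: "b \<le> v s" if "s \<in> {0..1}" for s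
    using v that by (auto simp: mono_lift_def mono_on_def)
  have "path (u +++ v)"
    using u v by (intro path_join_imp) (auto simp: mono_lift_def pathstart_def pathfinish_def)
  moreover have "mono_on {0..1} (u +++ v)"
  proof (rule mono_onI)
    fix r s :: real assume rs: "r \<in> {0..1}" "s \<in> {0..1}" "r \<le> s"
    have um: "u x \<le> u y" if "0 \<le> x" "x \<le> y" "y \<le> 1" for x y
      using u(1) that by (auto simp: mono_lift_def mono_on_def)
    have vm: "v x \<le> v y" if "0 \<le> x" "x \<le> y" "y \<le> 1" for x y
      using v(1) that by (auto simp: mono_lift_def mono_on_def)
    consider "s \<le> 1/2" | "r \<le> 1/2" "1/2 < s" | "1/2 < r"
      using rs by linarith
    then show "(u +++ v) r \<le> (u +++ v) s"
    proof cases
      case 1 then show ?thesis using rs um[of "2 * r" "2 * s"] by (simp add: joinpaths_def)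
    next
      case 2
      then show ?thesis
        using rs ub[of "2 * r"] vb[of "2 * s-1"] by (simp add: joinpaths_def)
    next
      case 3 then show ?thesis using rs vm[of "2 * r-1" "2 * s-1"] by (simp add: joinpaths_def)
    qed
  qed
  moreover have "(p +++ q) s = proj ((u +++ v) s)" if "s \<in> {0..1}" for s
    using u v that by (simp add: joinpaths_def mono_lift_def)
  ultimately have "mono_lift (p +++ q) (u +++ v)"
    by (simp add: mono_lift_def)
  moreover have "(u +++ v) 0 = a" "(u +++ v) 1 = c"
    using u v by (simp_all add: joinpaths_def)
  ultimately show ?thesis
    by (auto simp: path_class_def)
qed

lemma degree_one_loops_proj: "degree_one_loops (proj a) = path_class a (a + 1)"
proof
  show "path_class a (a + 1) \<subseteq> degree_one_loops (proj a)"
  proof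
    fix p assume p: "p \<in> path_class a (a + 1)"
    then have "p \<in> mono_paths (proj a) (proj a)"
      using path_class_subset_mono_paths[of a "a + 1"] proj_add_of_int[of a 1] by auto
    moreover obtain u where "mono_lift p u" "u 1 = u 0 + 1"
      using p by (auto simp: path_class_def)
    ultimately show "p \<in> degree_one_loops (proj a)"
      unfolding degree_one_loops_def mono_lift_def by blast
  qed
  show "degree_one_loops (proj a) \<subseteq> path_class a (a + 1)"
  proof
    fix p assume "p \<in> degree_one_loops (proj a)"
    then obtain u where p: "p \<in> mono_paths (proj a) (proj a)" and u: "mono_lift p u" "u 1 = u 0 + 1"
      by (auto simp: degree_one_loops_def mono_lift_def)
    have "proj a = proj (u 0)"
      using p u by (auto simp: mono_lift_def mono_paths_iff pathstart_def)
    then obtain k where k: "a = u 0 + of_int k"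
      by (rule proj_eqE)
    have "p \<in> path_class (u 0) (u 0 + 1)"
      using u by (auto simp: path_class_def)
    then show "p \<in> path_class a (a + 1)"
      using path_class_shift[of "u 0" k "u 0 + 1"] by (simp add: k algebra_simps)
  qed
qed

section \<open>The circle as a category\<close>

lemma segment_arrow_eq: "a \<le> b \<Longrightarrow> segment_arrow a b = (proj a, path_class a b, proj b)"
  by (simp add: segment_arrow_def homotopy_rel_path_class linepath_in_path_class)

lemma segment_arrow_shift:
  "a \<le> b \<Longrightarrow> segment_arrow (a + of_int k) (b + of_int k) = segment_arrow a b"
  by (simp add: segment_arrow_eq path_class_shift)

text \<open>The displacement of a class is well defined: a path lying in both classes is homotopic to itself.\<close>

lemma segment_arrow_inj:
  assumes "a \<le> b" "a \<le> c" "segment_arrow a b = segment_arrow a c"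
  shows "b = c"
proof -
  have "path_class a b = path_class a c"
    using assms by (simp add: segment_arrow_eq)
  then have "proj \<circ> linepath a b \<in> path_class a b" "proj \<circ> linepath a b \<in> path_class a c"
    using linepath_in_path_class[OF assms(1)] by auto
  then show ?thesis
    using homotopic_in_path_class[of "proj \<circ> linepath a b" a b "proj \<circ> linepath a b"]
      mono_lift_displacement[of "proj \<circ> linepath a b" "proj \<circ> linepath a b"]
    by (fastforce simp: path_class_def)
qed

text \<open>A lift of the source point can be fixed in advance, and then the arrows correspond to the possible
  end points of lifts.\<close>

lemma Hom_circle_cat:
  "Hom circle_cat (proj a) y = {segment_arrow a b | b. a \<le> b \<and> proj b = y}"
proof (intro equalityI subsetI)
  fix f assume "f \<in> Hom circle_cat (proj a) y"
  then obtain P where f: "f = (proj a, P, y)" and "P \<in> mono_paths (proj a) y // homotopy_rel (proj a) y"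
    by (auto simp: Hom_def circle_cat_def)
  then obtain p where p: "p \<in> mono_paths (proj a) y" "P = homotopy_rel (proj a) y `` {p}"
    by (auto elim: quotientE)
  from p(1) obtain b where "a \<le> b" "y = proj b" "p \<in> path_class a b"
    by (rule mono_paths_path_classE)
  then show "f \<in> {segment_arrow a b | b. a \<le> b \<and> proj b = y}"
    using f p(2) by (metis (mono_tags, lifting) homotopy_rel_path_class mem_Collect_eq segment_arrow_eq)
next
  fix f assume "f \<in> {segment_arrow a b | b. a \<le> b \<and> proj b = y}"
  then obtain b where b: "a \<le> b" "proj b = y" "f = segment_arrow a b"
    by blast
  have "proj \<circ> linepath a b \<in> mono_paths (proj a) (proj b)"
    using linepath_in_path_class[OF b(1)] path_class_subset_mono_paths by blast
  then have "homotopy_rel (proj a) (proj b) `` {proj \<circ> linepath a b}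
      \<in> mono_paths (proj a) (proj b) // homotopy_rel (proj a) (proj b)"
    by (rule quotientI)
  then show "f \<in> Hom circle_cat (proj a) y"
    using b by (auto simp: Hom_def circle_cat_def segment_arrow_def)
qed

lemma segment_arrow_in_Hom: "a \<le> b \<Longrightarrow> segment_arrow a b \<in> Hom circle_cat (proj a) (proj b)"
  by (auto simp: Hom_circle_cat)

lemma Comp_segment_arrow:
  assumes "a \<le> b" "b \<le> c"
  shows "Comp circle_cat (segment_arrow b c) (segment_arrow a b) = segment_arrow a c"
proof -
  let ?J = "{p +++ q | p q. p \<in> path_class a b \<and> q \<in> path_class b c}"
  have "homotopy_rel (proj a) (proj c) `` ?J = (\<Union>r\<in>?J. homotopy_rel (proj a) (proj c) `` {r})"
    by blast
  also have "\<dots> = (\<Union>r\<in>?J. path_class a c)"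
  proof (rule SUP_cong)
    show "homotopy_rel (proj a) (proj c) `` {r} = path_class a c" if "r \<in> ?J" for r
      using that path_class_join by (auto intro!: homotopy_rel_path_class)
  qed simp
  also have "\<dots> = path_class a c"
    using linepath_in_path_class[OF assms(1)] linepath_in_path_class[OF assms(2)] by auto
  finally have "homotopy_rel (proj a) (proj c) `` ?J = path_class a c" .
  then show ?thesis
    using assms by (simp add: segment_arrow_eq circle_cat_def)
qed

lemma Idt_circle_cat: "Idt circle_cat (proj a) = segment_arrow a a"
proof -
  have "proj \<circ> linepath a a = (\<lambda>_. proj a)"
    by (auto simp: linepath_def algebra_simps)
  then show ?thesis
    by (simp add: circle_cat_def segment_arrow_def)
qed

lemma Loop_circle_cat: "Loop circle_cat (proj a) = segment_arrow a (a + 1)"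
  using proj_add_of_int[of a 1]
  by (simp add: circle_cat_def segment_arrow_eq degree_one_loops_proj)

text \<open>Composable arrows can be represented by adjacent intervals of \<open>\<real>\<close>, for which the axioms are
  instances of \<open>Comp_segment_arrow\<close>; the loop is natural because the interval from \<open>a + 1\<close> to
  \<open>b + 1\<close> represents the same arrow as the one from \<open>a\<close> to \<open>b\<close>.\<close>

lemma zplus_category_circle_cat: "zplus_category circle_cat"
proof -
  have seg_fromE: thesis
    if "f \<in> Hom circle_cat (proj a) y" "\<And>b. a \<le> b \<Longrightarrow> y = proj b \<Longrightarrow>
      f = segment_arrow a b \<Longrightarrow> thesis" for f a y thesis
    using that by (auto simp: Hom_circle_cat)
  have segE: thesis
    if f: "f \<in> Hom circle_cat x y" and step: "\<And>a b. a \<le> b \<Longrightarrow> x = proj a \<Longrightarrow> y = proj b \<Longrightarrow>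
      f = segment_arrow a b \<Longrightarrow> thesis" for f x y thesis
  proof -
    obtain a where x: "x = proj a" by (rule proj_surj)
    show thesis
      using f unfolding x by (rule seg_fromE) (rule step[OF _ x])
  qed
  show ?thesis
  proof unfold_locales
    fix f :: circle_arrow
    show "Dom circle_cat f \<in> Obj circle_cat" "Cod circle_cat f \<in> Obj circle_cat"
      by (simp_all add: circle_cat_def)
  next
    fix x :: circle
    obtain a where x: "x = proj a" by (rule proj_surj)
    have loop: "Loop circle_cat x = segment_arrow a (a + 1)" and idt: "Idt circle_cat x = segment_arrow a a"
      by (simp_all add: x Loop_circle_cat Idt_circle_cat)
    show "Idt circle_cat x \<in> Hom circle_cat x x"
      by (simp only: idt) (simp add: segment_arrow_in_Hom x)
    show "Loop circle_cat x \<in> Hom circle_cat x x"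
      using proj_add_of_int[of a 1] segment_arrow_in_Hom[of a "a + 1"] by (simp only: loop) (simp add: x)
    show "Loop circle_cat x \<noteq> Idt circle_cat x"
      using segment_arrow_inj[of a "a + 1" a] by (auto simp: loop idt)
  next
    fix f g x y z
    assume f: "f \<in> Hom circle_cat x y" and g: "g \<in> Hom circle_cat y z"
    from f obtain a b where ab: "a \<le> b" "x = proj a" "y = proj b" "f = segment_arrow a b"
      by (rule segE)
    from g obtain c where "b \<le> c" "z = proj c" "g = segment_arrow b c"
      unfolding ab by (rule seg_fromE)
    with ab show "Comp circle_cat g f \<in> Hom circle_cat x z"
      by (auto simp: Comp_segment_arrow intro!: segment_arrow_in_Hom)
  next
    fix f x y
    assume f: "f \<in> Hom circle_cat x y"
    then obtain a b where ab: "a \<le> b" "x = proj a" "y = proj b" "f = segment_arrow a b"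
      by (rule segE)
    then show "Comp circle_cat (Idt circle_cat y) f = f" "Comp circle_cat f (Idt circle_cat x) = f"
      by (simp_all add: Idt_circle_cat Comp_segment_arrow)
    have "Comp circle_cat (segment_arrow (a + 1) (b + 1)) (segment_arrow a (a + 1))
        = Comp circle_cat (segment_arrow b (b + 1)) (segment_arrow a b)"
      using ab by (simp add: Comp_segment_arrow)
    then show "Comp circle_cat f (Loop circle_cat x) = Comp circle_cat (Loop circle_cat y) f"
      using ab segment_arrow_shift[of a b 1] by (simp add: Loop_circle_cat)
  next
    fix f g h w x y z
    assume f: "f \<in> Hom circle_cat w x" and g: "g \<in> Hom circle_cat x y" and h: "h \<in> Hom circle_cat y z"
    from f obtain a b where ab: "a \<le> b" "w = proj a" "x = proj b" "f = segment_arrow a b"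
      by (rule segE)
    from g obtain c where bc: "b \<le> c" "y = proj c" "g = segment_arrow b c"
      unfolding ab by (rule seg_fromE)
    from h obtain d where "c \<le> d" "z = proj d" "h = segment_arrow c d"
      unfolding bc by (rule seg_fromE)
    with ab bc show "Comp circle_cat (Comp circle_cat h g) f = Comp circle_cat h (Comp circle_cat g f)"
      by (simp add: Comp_segment_arrow)
  qed
qed

lemma Hom_full_subcategory:
  "Hom (full_subcategory S C) x y = (if x \<in> S \<and> y \<in> S then Hom C x y else {})"
  by (auto simp: Hom_def full_subcategory_def)

lemma zplus_category_full_subcategory:
  assumes "zplus_category C"
  shows "zplus_category (full_subcategory S C)"
proof -
  interpret zplus_category C by (rule assms)
  have [simp]: "Idt (full_subcategory S C) = Idt C" "Comp (full_subcategory S C) = Comp C"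
    "Loop (full_subcategory S C) = Loop C" "Dom (full_subcategory S C) = Dom C"
    "Cod (full_subcategory S C) = Cod C" "Obj (full_subcategory S C) = Obj C \<inter> S"
    "Arr (full_subcategory S C) = {f \<in> Arr C. Dom C f \<in> S \<and> Cod C f \<in> S}"
    by (simp_all add: full_subcategory_def)
  show ?thesis
    by unfold_locales
      (auto simp: Hom_full_subcategory dom_in cod_in idt_in comp_in idt_left idt_right comp_assoc
        loop_in loop_not_idt loop_natural split: if_splits)
qed

lemma Hom_opposite: "Hom (opposite C) x y = Hom C y x"
  by (auto simp: Hom_def opposite_def)

lemma opposite_simps [simp]:
  "Obj (opposite C) = Obj C" "Arr (opposite C) = Arr C"
  "Idt (opposite C) = Idt C" "Comp (opposite C) g f = Comp C f g"
  "Dom (opposite C) = Cod C" "Cod (opposite C) = Dom C"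
  by (simp_all add: opposite_def)

lemma Loop_opposite [simp]: "Loop (opposite C) = Loop C"
  by (simp add: opposite_def)

lemma zplus_category_opposite:
  assumes "zplus_category C"
  shows "zplus_category (opposite C)"
proof -
  interpret zplus_category C by (rule assms)
  show ?thesis
    by unfold_locales
      (auto simp: Hom_opposite dom_in cod_in idt_in comp_in idt_left idt_right comp_assoc
        loop_in loop_not_idt loop_natural)
qed

section \<open>Integer coordinates on the categories of points of the circle\<close>

text \<open>Points and arrows of \<open>cyc n\<close> in the coordinates in which the circle has length \<open>n + 1\<close>. All
  integers are allowed, so the description is periodic: translating every coordinate by a
  multiple of \<open>n + 1\<close> changes nothing.\<close>

definition int_point :: "nat \<Rightarrow> int \<Rightarrow> circle" where
  "int_point n k = proj (of_int k / (real n + 1))"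

definition int_segment :: "nat \<Rightarrow> int \<Rightarrow> int \<Rightarrow> circle_arrow" where
  "int_segment n k l = segment_arrow (of_int k / (real n + 1)) (of_int l / (real n + 1))"

lemma int_point_shift [simp]: "int_point n (k + c * (int n + 1)) = int_point n k"
proof -
  have "of_int (k + c * (int n + 1)) / (real n + 1) = of_int k / (real n + 1) + of_int c"
    by (simp add: field_simps)
  then show ?thesis
    by (simp only: int_point_def proj_add_of_int)
qed

lemma int_point_eqE:
  assumes "int_point n l = int_point n k"
  obtains c where "l = k + c * (int n + 1)"
proof -
  from assms obtain c where "of_int l / (real n + 1) = of_int k / (real n + 1) + of_int c"
    unfolding int_point_def by (rule proj_eqE)
  then have "real_of_int l = of_int (k + c * (int n + 1))"
    by (simp add: field_simps)
  then show thesis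
    using that of_int_eq_iff by blast
qed

lemma cyc_point_eq: "cyc_point n i = int_point n (int i)"
  by (simp add: cyc_point_def int_point_def add.commute)

lemma order_arrow_eq: "order_arrow n i j = int_segment n (int i) (int j)"
  by (simp add: order_arrow_def int_segment_def add.commute)

lemma wrap_arrow_eq: "wrap_arrow n = int_segment n (int n) (int n + 1)"
  by (simp add: wrap_arrow_def int_segment_def add.commute)

lemma int_segment_shift:
  assumes "k \<le> l"
  shows "int_segment n (k + c * (int n + 1)) (l + c * (int n + 1)) = int_segment n k l"
proof -
  have "of_int (k + c * (int n + 1)) / (real n + 1) = of_int k / (real n + 1) + of_int c" for k
    by (simp add: field_simps)
  moreover have "of_int k / (real n + 1) \<le> of_int l / (real n + 1)"
    using assms by (simp add: divide_right_mono)
  ultimately show ?thesis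
    by (simp only: int_segment_def segment_arrow_shift)
qed

lemma int_segment_inj:
  assumes "k \<le> l" "k \<le> p" "int_segment n k l = int_segment n k p"
  shows "l = p"
proof -
  have "of_int l / (real n + 1) = of_int p / (real n + 1)"
    using assms unfolding int_segment_def by (intro segment_arrow_inj) (auto simp: divide_right_mono)
  then show ?thesis by simp
qed

lemma Obj_cyc: "Obj (cyc n) = range (int_point n)"
proof -
  have "int_point n k \<in> cyc_point n ` {0..n}" for k
  proof
    have "int_point n k = int_point n (k mod (int n + 1) + (k div (int n + 1)) * (int n + 1))"
      by (simp only: mod_div_mult_eq)
    also have "\<dots> = int_point n (k mod (int n + 1))"
      by (rule int_point_shift)
    also have "\<dots> = cyc_point n (nat (k mod (int n + 1)))"
      by (simp add: cyc_point_eq)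
    finally show "int_point n k = cyc_point n (nat (k mod (int n + 1)))" .
    have "k mod (int n + 1) \<le> int n"
      using pos_mod_bound[of "int n + 1" k] by linarith
    then show "nat (k mod (int n + 1)) \<in> {0..n}"
      by simp
  qed
  then show ?thesis
    by (auto simp: cyc_def full_subcategory_def circle_cat_def cyc_point_eq)
qed

lemma int_point_in_Obj [simp]: "int_point n k \<in> Obj (cyc n)"
  by (simp add: Obj_cyc)

lemma zplus_category_cyc: "zplus_category (cyc n)"
  unfolding cyc_def by (intro zplus_category_full_subcategory zplus_category_circle_cat)

lemma Hom_cyc:
  assumes "x \<in> Obj (cyc n)" "y \<in> Obj (cyc n)"
  shows "Hom (cyc n) x y = Hom circle_cat x y"
  using assms by (simp add: cyc_def Hom_full_subcategory) (simp add: full_subcategory_def)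

lemma int_segment_in_Hom:
  assumes "k \<le> l" shows "int_segment n k l \<in> Hom (cyc n) (int_point n k) (int_point n l)"
  unfolding Hom_cyc[OF int_point_in_Obj int_point_in_Obj]
  using assms by (simp add: int_segment_def int_point_def segment_arrow_in_Hom divide_right_mono)

lemma Hom_cycE:
  assumes "f \<in> Hom (cyc n) (int_point n k) (int_point n l)"
  obtains p where "k \<le> p" "int_point n p = int_point n l" "f = int_segment n k p"
proof -
  from assms obtain b where b: "of_int k / (real n + 1) \<le> b" "proj b = int_point n l"
      "f = segment_arrow (of_int k / (real n + 1)) b"
    unfolding Hom_cyc[OF int_point_in_Obj int_point_in_Obj]
    by (subst (asm) int_point_def) (auto simp: Hom_circle_cat)
  from b(2) obtain c where "b = of_int l / (real n + 1) + of_int c"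
    unfolding int_point_def by (rule proj_eqE)
  then have p: "b = of_int (l + c * (int n + 1)) / (real n + 1)"
    by (simp add: field_simps)
  then have "k \<le> l + c * (int n + 1)"
    using b(1) by (simp only: divide_le_cancel of_int_le_iff)
  then show thesis
    using b p that[of "l + c * (int n + 1)"] by (simp only: int_segment_def int_point_shift)
qed

lemma Arr_cyc: "Arr (cyc n) = {int_segment n k l | k l. k \<le> l}"
proof (intro equalityI subsetI)
  interpret zplus_category "cyc n" by (rule zplus_category_cyc)
  fix f assume f: "f \<in> Arr (cyc n)"
  then obtain k l where "Dom (cyc n) f = int_point n k" "Cod (cyc n) f = int_point n l"
    using dom_in[OF f] cod_in[OF f] by (auto simp: Obj_cyc)
  with f have "f \<in> Hom (cyc n) (int_point n k) (int_point n l)"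
    by (simp add: Hom_def)
  then show "f \<in> {int_segment n k l | k l. k \<le> l}"
    by (rule Hom_cycE) blast
next
  fix f assume "f \<in> {int_segment n k l | k l. k \<le> l}"
  then show "f \<in> Arr (cyc n)"
    using int_segment_in_Hom by (auto simp: Hom_def)
qed

lemma int_segment_eqE:
  assumes "k \<le> l" "k' \<le> l'" "int_segment n k' l' = int_segment n k l"
  obtains c where "k' = k + c * (int n + 1)" "l' = l + c * (int n + 1)"
proof -
  have "int_point n k' = int_point n k"
    using assms int_segment_in_Hom[of k l n] int_segment_in_Hom[of k' l' n] by (simp add: Hom_def)
  then obtain c where c: "k' = k + c * (int n + 1)"
    by (rule int_point_eqE)
  have "int_segment n k' (l + c * (int n + 1)) = int_segment n k' l'"
    using assms c by (simp only: int_segment_shift)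
  then have "l' = l + c * (int n + 1)"
    using assms c by (metis add_le_cancel_right int_segment_inj)
  with c show thesis by (rule that)
qed

lemma Comp_int_segment:
  assumes "k \<le> l" "l \<le> p"
  shows "Comp (cyc n) (int_segment n l p) (int_segment n k l) = int_segment n k p"
  using assms by (simp add: cyc_def full_subcategory_def int_segment_def Comp_segment_arrow divide_right_mono)

lemma Idt_cyc: "Idt (cyc n) (int_point n k) = int_segment n k k"
  by (simp add: cyc_def full_subcategory_def int_segment_def int_point_def Idt_circle_cat)

lemma Loop_cyc: "Loop (cyc n) (int_point n k) = int_segment n k (k + int n + 1)"
proof -
  have "of_int (k + int n + 1) / (real n + 1) = of_int k / (real n + 1) + 1"
    by (simp add: field_simps)
  then show ?thesis
    by (simp only: cyc_def full_subcategory_def int_segment_def int_point_def)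
      (simp add: Loop_circle_cat)
qed

text \<open>The Boolean records whether a functor is contravariant; a contravariant one reverses the order
  of the integers, so its conditions acquire this sign.\<close>

definition orient :: "bool \<Rightarrow> int" where
  "orient s = (if s then - 1 else 1)"

lemma orient_simps [simp]: "orient True = - 1" "orient False = 1"
  by (simp_all add: orient_def)

definition cyc_target :: "bool \<Rightarrow> nat \<Rightarrow> (circle, circle_arrow) zcat" where
  "cyc_target s n = (if s then opposite (cyc n) else cyc n)"

text \<open>The arrow between two points of the line in the direction in which there is one. In
  \<open>cyc_target s n\<close> it goes from \<open>k\<close> to \<open>l\<close> whenever \<open>orient s * k \<le> orient s * l\<close>, so that the
  facts below have the same form for the category and its opposite.\<close>

definition int_span :: "nat \<Rightarrow> int \<Rightarrow> int \<Rightarrow> circle_arrow" where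
  "int_span n k l = int_segment n (min k l) (max k l)"

lemma zplus_category_cyc_target: "zplus_category (cyc_target s n)"
  by (simp add: cyc_target_def zplus_category_cyc zplus_category_opposite)

lemma Obj_cyc_target: "Obj (cyc_target s n) = range (int_point n)"
  by (simp add: cyc_target_def Obj_cyc)

lemma int_span_in_Hom:
  "orient s * k \<le> orient s * l \<Longrightarrow> int_span n k l \<in> Hom (cyc_target s n) (int_point n k) (int_point n l)"
  by (cases s) (simp_all add: cyc_target_def int_span_def Hom_opposite int_segment_in_Hom)

lemma Hom_cyc_targetE:
  assumes "f \<in> Hom (cyc_target s n) (int_point n k) (int_point n l)"
  obtains p where "orient s * k \<le> orient s * p" "int_point n p = int_point n l" "f = int_span n k p"
proof (cases s)
  case False
  with assms have "f \<in> Hom (cyc n) (int_point n k) (int_point n l)"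
    by (simp add: cyc_target_def)
  then show thesis
    by (rule Hom_cycE) (use that in \<open>simp add: False int_span_def\<close>)
next
  case True
  with assms have "f \<in> Hom (cyc n) (int_point n l) (int_point n k)"
    by (simp add: cyc_target_def Hom_opposite)
  then obtain q where q: "l \<le> q" "int_point n q = int_point n k" "f = int_segment n l q"
    by (rule Hom_cycE)
  from q(2) obtain c where c: "q = k + c * (int n + 1)"
    by (rule int_point_eqE)
  let ?p = "l + (- c) * (int n + 1)"
  have "?p \<le> k"
    using q(1) c by simp
  moreover have "f = int_segment n ?p k"
    using int_segment_shift[OF q(1), of n "- c"] q(3) c by simp
  ultimately show thesis
    using that[of ?p] int_point_shift[of n l "- c"] by (simp add: True int_span_def)
qed

lemma Comp_int_span:
  assumes "orient s * k \<le> orient s * l" "orient s * l \<le> orient s * p"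
  shows "Comp (cyc_target s n) (int_span n l p) (int_span n k l) = int_span n k p"
  using assms by (cases s) (simp_all add: cyc_target_def int_span_def Comp_int_segment)

lemma Idt_int_span: "Idt (cyc_target s n) (int_point n k) = int_span n k k"
  by (simp add: cyc_target_def int_span_def Idt_cyc)

lemma int_span_shift: "int_span n (k + c * (int n + 1)) (l + c * (int n + 1)) = int_span n k l"
  using int_segment_shift[of k l n c] int_segment_shift[of l k n c] by (simp add: int_span_def min_def max_def)

lemma Loop_int_span:
  "Loop (cyc_target s n) (int_point n k) = int_span n k (k + orient s * (int n + 1))"
  using int_segment_shift[of k "k + int n + 1" n "- 1"]
  by (cases s) (simp_all add: cyc_target_def int_span_def Loop_cyc algebra_simps)

lemma int_span_inj:
  assumes "orient s * k \<le> orient s * l" "orient s * k \<le> orient s * p" "int_span n k l = int_span n k p"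
  shows "l = p"
proof (cases s)
  case False
  with assms int_segment_inj show ?thesis
    by (simp add: int_span_def)
next
  case True
  with assms have "l \<le> k" "p \<le> k" "int_segment n l k = int_segment n p k"
    by (simp_all add: int_span_def)
  then show ?thesis
    by (auto elim: int_segment_eqE)
qed

lemma int_point_nonneg: obtains i where "0 \<le> i" "int_point n k = int_point n i"
proof -
  have "int_point n (k mod (int n + 1)) = int_point n (k mod (int n + 1) + (k div (int n + 1)) * (int n + 1))"
    by simp
  also have "\<dots> = int_point n k"
    by (simp only: mod_div_mult_eq)
  finally show thesis
    using that[of "k mod (int n + 1)"] by simp
qed

lemma int_segment_nonneg:
  assumes "k \<le> l" obtains i j where "0 \<le> i" "i \<le> j" "int_segment n k l = int_segment n i j"
proof -
  let ?c = "- (k div (int n + 1))"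
  have k: "k + ?c * (int n + 1) = k mod (int n + 1)"
    by (simp add: minus_div_mult_eq_mod)
  then have "0 \<le> k + ?c * (int n + 1)"
    by simp
  then show thesis
    using assms int_segment_shift[OF assms, of n ?c] that[of "k + ?c * (int n + 1)" "l + ?c * (int n + 1)"]
    by simp
qed

section \<open>Functors as monotone maps of the integers\<close>

text \<open>The maps of the integers that represent the covariant (\<open>s = False\<close>) and contravariant
  (\<open>s = True\<close>) functors from \<open>cyc m\<close> to \<open>cyc n\<close>.\<close>

definition cyc_lift :: "nat \<Rightarrow> nat \<Rightarrow> bool \<Rightarrow> (int \<Rightarrow> int) \<Rightarrow> bool" where
  "cyc_lift m n s \<phi> \<longleftrightarrow> (\<forall>k. \<phi> (k + (int m + 1)) = \<phi> k + orient s * (int n + 1)) \<and>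
    (\<forall>k l. k \<le> l \<longrightarrow> orient s * \<phi> k \<le> orient s * \<phi> l)"

text \<open>The functor represented by \<open>\<phi>\<close>. Coordinates of points and arrows are chosen arbitrarily; the
  choice does not matter because \<open>\<phi>\<close> carries translations by multiples of \<open>m + 1\<close> to
  translations by multiples of \<open>n + 1\<close>; see \<open>on_obj_cyc_ftor\<close> and
  \<open>on_arr_cyc_ftor\<close>.\<close>

definition cyc_ftor :: "nat \<Rightarrow> nat \<Rightarrow> (int \<Rightarrow> int) \<Rightarrow> cyc_functor" where
  "cyc_ftor m n \<phi> =
    \<lparr>on_obj = (\<lambda>x\<in>Obj (cyc m). int_point n (\<phi> (SOME k. x = int_point m k))),
     on_arr = (\<lambda>f\<in>Arr (cyc m).
       case SOME (k, l). k \<le> l \<and> f = int_segment m k l of (k, l) \<Rightarrow> int_span n (\<phi> k) (\<phi> l))\<rparr>"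

lemma periodic_add_mult:
  fixes \<phi> :: "int \<Rightarrow> int"
  assumes step: "\<And>k. \<phi> (k + M) = \<phi> k + N"
  shows "\<phi> (k + c * M) = \<phi> k + c * N"
proof (induction c rule: int_induct[where k = 0])
  case base then show ?case by simp
next
  case (step1 i)
  have "\<phi> (k + (i + 1) * M) = \<phi> ((k + i * M) + M)"
    by (simp add: algebra_simps)
  also have "\<dots> = \<phi> k + (i + 1) * N"
    by (simp only: step step1) (simp add: algebra_simps)
  finally show ?case .
next
  case (step2 i)
  have "\<phi> (k + i * M) = \<phi> ((k + (i - 1) * M) + M)"
    by (simp add: algebra_simps)
  also have "\<dots> = \<phi> (k + (i - 1) * M) + N"
    by (rule step)
  finally show ?case
    using step2 by (simp add: algebra_simps)
qed

lemma cyc_lift_shift: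
  "cyc_lift m n s \<phi> \<Longrightarrow> \<phi> (k + c * (int m + 1)) = \<phi> k + (orient s * c) * (int n + 1)"
  using periodic_add_mult[of \<phi> "int m + 1" "orient s * (int n + 1)" k c]
  by (simp add: cyc_lift_def mult_ac)

lemma cyc_lift_mono: "cyc_lift m n s \<phi> \<Longrightarrow> k \<le> l \<Longrightarrow> orient s * \<phi> k \<le> orient s * \<phi> l"
  by (simp add: cyc_lift_def)

lemma on_obj_cyc_ftor:
  assumes "cyc_lift m n s \<phi>"
  shows "on_obj (cyc_ftor m n \<phi>) (int_point m k) = int_point n (\<phi> k)"
proof -
  define l where "l = (SOME l. int_point m k = int_point m l)"
  have "int_point m l = int_point m k"
    unfolding l_def by (metis (mono_tags, lifting) someI)
  then obtain c where "l = k + c * (int m + 1)"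
    by (rule int_point_eqE)
  then have "int_point n (\<phi> l) = int_point n (\<phi> k)"
    by (simp only: cyc_lift_shift[OF assms] int_point_shift)
  then show ?thesis
    by (simp add: cyc_ftor_def l_def)
qed

lemma on_arr_cyc_ftor:
  assumes "cyc_lift m n s \<phi>" "k \<le> l"
  shows "on_arr (cyc_ftor m n \<phi>) (int_segment m k l) = int_span n (\<phi> k) (\<phi> l)"
proof -
  let ?P = "\<lambda>(k', l'). k' \<le> l' \<and> int_segment m k l = int_segment m k' l'"
  obtain k' l' where kl': "(SOME x. ?P x) = (k', l')"
    by fastforce
  have "?P (k, l)"
    using assms by simp
  then have "?P (SOME x. ?P x)"
    by (rule someI)
  then have "k' \<le> l'" "int_segment m k' l' = int_segment m k l"
    by (simp_all add: kl')
  with assms(2) obtain c where "k' = k + c * (int m + 1)" "l' = l + c * (int m + 1)"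
    by (rule int_segment_eqE)
  then have "int_span n (\<phi> k') (\<phi> l') = int_span n (\<phi> k) (\<phi> l)"
    by (simp only: cyc_lift_shift[OF assms(1)] int_span_shift)
  moreover have "int_segment m k l \<in> Arr (cyc m)"
    using assms(2) by (auto simp: Arr_cyc)
  ultimately show ?thesis
    by (simp add: cyc_ftor_def kl')
qed

lemma zplus_functor_cyc_ftor:
  assumes lift: "cyc_lift m n s \<phi>"
  shows "zplus_functor (cyc m) (cyc_target s n) (cyc_ftor m n \<phi>)"
proof -
  interpret S: zplus_category "cyc m" by (rule zplus_category_cyc)
  interpret T: zplus_category "cyc_target s n" by (rule zplus_category_cyc_target)
  note obj = on_obj_cyc_ftor[OF lift] and arr = on_arr_cyc_ftor[OF lift] and mono = cyc_lift_mono[OF lift]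
  have homE: thesis
    if f: "f \<in> Hom (cyc m) x y" and step: "\<And>k l. k \<le> l \<Longrightarrow> x = int_point m k \<Longrightarrow> y = int_point m l \<Longrightarrow>
      f = int_segment m k l \<Longrightarrow> thesis" for f x y thesis
  proof -
    have "f \<in> Arr (cyc m)" "Dom (cyc m) f = x" "Cod (cyc m) f = y"
      using f by (simp_all add: Hom_def)
    moreover from this obtain k l where "k \<le> l" "f = int_segment m k l"
      by (auto simp: Arr_cyc)
    ultimately show thesis
      using step int_segment_in_Hom[of k l m] by (simp add: Hom_def)
  qed
  show ?thesis
  proof unfold_locales
    show "on_obj (cyc_ftor m n \<phi>) \<in> Obj (cyc m) \<rightarrow>\<^sub>E Obj (cyc_target s n)"
      by (auto simp: cyc_ftor_def Obj_cyc_target)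
    show "on_arr (cyc_ftor m n \<phi>) \<in> extensional (Arr (cyc m))"
      by (simp add: cyc_ftor_def)
  next
    fix f x y assume "f \<in> Hom (cyc m) x y"
    then show "on_arr (cyc_ftor m n \<phi>) f
        \<in> Hom (cyc_target s n) (on_obj (cyc_ftor m n \<phi>) x) (on_obj (cyc_ftor m n \<phi>) y)"
      by (rule homE) (simp add: obj arr mono int_span_in_Hom)
  next
    fix f g x y z assume f: "f \<in> Hom (cyc m) x y" and g: "g \<in> Hom (cyc m) y z"
    from f obtain k l where kl: "k \<le> l" "x = int_point m k" "y = int_point m l" "f = int_segment m k l"
      by (rule homE)
    have "z \<in> Obj (cyc m)"
      using g S.cod_in[of g] by (simp add: Hom_def)
    then obtain p where "z = int_point m p"
      by (auto simp: Obj_cyc)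
    with g kl have "g \<in> Hom (cyc m) (int_point m l) (int_point m p)"
      by simp
    then obtain q where "l \<le> q" "g = int_segment m l q"
      by (rule Hom_cycE)
    with kl show "on_arr (cyc_ftor m n \<phi>) (Comp (cyc m) g f)
        = Comp (cyc_target s n) (on_arr (cyc_ftor m n \<phi>) g) (on_arr (cyc_ftor m n \<phi>) f)"
      by (simp add: Comp_int_segment arr Comp_int_span mono)
  next
    fix x assume "x \<in> Obj (cyc m)"
    then obtain k where x: "x = int_point m k"
      by (auto simp: Obj_cyc)
    show "on_arr (cyc_ftor m n \<phi>) (Idt (cyc m) x) = Idt (cyc_target s n) (on_obj (cyc_ftor m n \<phi>) x)"
      by (simp add: x Idt_cyc arr obj Idt_int_span)
    have "\<phi> (k + int m + 1) = \<phi> k + orient s * (int n + 1)"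
      using lift by (simp add: cyc_lift_def add.assoc)
    then show "on_arr (cyc_ftor m n \<phi>) (Loop (cyc m) x) = Loop (cyc_target s n) (on_obj (cyc_ftor m n \<phi>) x)"
      by (simp add: x Loop_cyc arr obj Loop_int_span)
  qed
qed

lemma cyc_functor_eqI:
  assumes "on_obj F \<in> extensional (Obj (cyc m))" "on_obj G \<in> extensional (Obj (cyc m))"
    and "on_arr F \<in> extensional (Arr (cyc m))" "on_arr G \<in> extensional (Arr (cyc m))"
    and obj: "\<And>k. 0 \<le> k \<Longrightarrow> on_obj F (int_point m k) = on_obj G (int_point m k)"
    and arr: "\<And>k l. 0 \<le> k \<Longrightarrow> k \<le> l \<Longrightarrow> on_arr F (int_segment m k l) = on_arr G (int_segment m k l)"
  shows "F = (G :: cyc_functor)"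
proof -
  have "on_obj F = on_obj G"
    using assms(1,2)
  proof (rule extensionalityI)
    fix x assume "x \<in> Obj (cyc m)"
    then obtain k where "x = int_point m k"
      by (auto simp: Obj_cyc)
    then obtain i where "0 \<le> i" "x = int_point m i"
      using int_point_nonneg by metis
    then show "on_obj F x = on_obj G x"
      by (simp add: obj)
  qed
  moreover have "on_arr F = on_arr G"
    using assms(3,4)
  proof (rule extensionalityI)
    fix f assume "f \<in> Arr (cyc m)"
    then obtain k l where "k \<le> l" "f = int_segment m k l"
      by (auto simp: Arr_cyc)
    then obtain i j where "0 \<le> i" "i \<le> j" "f = int_segment m i j"
      using int_segment_nonneg by metis
    then show "on_arr F f = on_arr G f"
      by (simp add: arr)
  qed
  ultimately show ?thesis
    by simp
qed

lemma zplus_functor_extensional: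
  assumes "zplus_functor C D F"
  shows "on_obj F \<in> extensional (Obj C)" "on_arr F \<in> extensional (Arr C)"
proof -
  interpret zplus_functor C D F by (rule assms)
  show "on_obj F \<in> extensional (Obj C)" "on_arr F \<in> extensional (Arr C)"
    using on_obj_in on_arr_ext by (auto simp: PiE_def)
qed

text \<open>Once a coordinate \<open>a\<close> of the image of the point \<open>0\<close> is chosen, the image of the arrow from \<open>0\<close> to
  \<open>k \<ge> 0\<close> starts at \<open>a\<close> and ends at a well-defined integer \<open>\<psi> k\<close>. Functoriality makes \<open>\<psi>\<close>
  monotone, and preservation of loops makes it periodic. Periodicity then extends it to the
  negative integers.\<close>

lemma zplus_functor_lift:
  assumes F: "zplus_functor (cyc m) (cyc_target s n) F"
  obtains \<phi> where "cyc_lift m n s \<phi>" "F = cyc_ftor m n \<phi>"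
proof -
  interpret zplus_functor "cyc m" "cyc_target s n" F by (rule F)
  let ?M = "int m + 1" and ?N = "orient s * (int n + 1)"
  have pt: "\<exists>l. on_obj F (int_point m k) = int_point n l" for k
    using on_obj_in int_point_in_Obj[of m k] by (fastforce simp: Obj_cyc_target)
  then obtain a where a: "on_obj F (int_point m 0) = int_point n a"
    by blast
  have "\<exists>p. 0 \<le> k \<longrightarrow> orient s * a \<le> orient s * p \<and> on_obj F (int_point m k) = int_point n p
      \<and> on_arr F (int_segment m 0 k) = int_span n a p" for k
  proof (cases "0 \<le> k")
    case True
    obtain l where l: "on_obj F (int_point m k) = int_point n l"
      using pt by blast
    have "on_arr F (int_segment m 0 k) \<in> Hom (cyc_target s n) (int_point n a) (int_point n l)"
      using on_arr_in[OF int_segment_in_Hom[OF True]] by (simp add: a l)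
    then show ?thesis
      by (rule Hom_cyc_targetE) (auto simp: l)
  qed simp
  then obtain \<psi> where \<psi>: "\<And>k. 0 \<le> k \<Longrightarrow> orient s * a \<le> orient s * \<psi> k"
    "\<And>k. 0 \<le> k \<Longrightarrow> on_obj F (int_point m k) = int_point n (\<psi> k)"
    "\<And>k. 0 \<le> k \<Longrightarrow> on_arr F (int_segment m 0 k) = int_span n a (\<psi> k)"
    by metis
  have seg: "orient s * \<psi> k \<le> orient s * \<psi> l \<and> on_arr F (int_segment m k l) = int_span n (\<psi> k) (\<psi> l)"
    if kl: "0 \<le> k" "k \<le> l" for k l
  proof -
    have l: "0 \<le> l" using kl by simp
    have "on_arr F (int_segment m k l) \<in> Hom (cyc_target s n) (int_point n (\<psi> k)) (int_point n (\<psi> l))"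
      using on_arr_in[OF int_segment_in_Hom[OF kl(2)]] \<psi>(2)[OF kl(1)] \<psi>(2)[OF l] by simp
    then obtain p where p: "orient s * \<psi> k \<le> orient s * p" "on_arr F (int_segment m k l) = int_span n (\<psi> k) p"
      by (rule Hom_cyc_targetE)
    have "int_span n a (\<psi> l) = on_arr F (Comp (cyc m) (int_segment m k l) (int_segment m 0 k))"
      using kl l by (simp add: Comp_int_segment \<psi>(3))
    also have "\<dots> = Comp (cyc_target s n) (int_span n (\<psi> k) p) (int_span n a (\<psi> k))"
      using map_comp[OF int_segment_in_Hom[OF kl(1)] int_segment_in_Hom[OF kl(2)]] kl by (simp add: \<psi>(3) p(2))
    also have "\<dots> = int_span n a p"
      using \<psi>(1)[OF kl(1)] p(1) by (rule Comp_int_span)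
    finally have "\<psi> l = p"
      using \<psi>(1)[OF l] \<psi>(1)[OF kl(1)] p(1) by (intro int_span_inj[of s a "\<psi> l" p n]) auto
    then show ?thesis
      using p by simp
  qed
  have per: "\<psi> (k + ?M) = \<psi> k + ?N" if k: "0 \<le> k" for k
  proof -
    have kM: "k \<le> k + ?M" by simp
    have "int_span n (\<psi> k) (\<psi> (k + ?M)) = on_arr F (Loop (cyc m) (int_point m k))"
      using seg[OF k kM] by (simp add: Loop_cyc add.assoc)
    also have "\<dots> = int_span n (\<psi> k) (\<psi> k + ?N)"
      using map_loop[OF int_point_in_Obj] by (simp add: \<psi>(2)[OF k] Loop_int_span)
    finally show ?thesis
      using seg[OF k kM] by (intro int_span_inj[of s "\<psi> k" _ _ n]) (cases s; simp)+
  qed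
  have per_nat: "\<psi> (k + int c * ?M) = \<psi> k + int c * ?N" if k: "0 \<le> k" for k c
  proof (induction c)
    case (Suc c)
    have "\<psi> (k + int (Suc c) * ?M) = \<psi> ((k + int c * ?M) + ?M)"
      by (simp add: algebra_simps)
    also have "\<dots> = \<psi> (k + int c * ?M) + ?N"
      using k by (intro per) simp
    also have "\<dots> = \<psi> k + int (Suc c) * ?N"
      by (simp only: Suc of_nat_Suc) (simp add: algebra_simps)
    finally show ?case .
  qed simp
  \<comment> \<open>the only extension of \<open>\<psi>\<close> to all integers that satisfies the periodicity condition\<close>
  define \<phi> where "\<phi> k = \<psi> (k mod ?M) + (k div ?M) * ?N" for k
  have \<phi>_nonneg: "\<phi> k = \<psi> k" if "0 \<le> k" for k
  proof -
    have "0 \<le> k div ?M"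
      using that by (simp add: pos_imp_zdiv_nonneg_iff)
    then have "\<psi> (k mod ?M + (k div ?M) * ?M) = \<psi> (k mod ?M) + (k div ?M) * ?N"
      using per_nat[of "k mod ?M" "nat (k div ?M)"] by simp
    then show ?thesis
      by (simp only: mod_div_mult_eq \<phi>_def)
  qed
  have \<phi>_per: "\<phi> (k + ?M) = \<phi> k + ?N" for k
  proof -
    have "(k + ?M) mod ?M = k mod ?M" "(k + ?M) div ?M = k div ?M + 1"
      by simp_all
    then show ?thesis
      unfolding \<phi>_def by (simp only:) (simp add: algebra_simps)
  qed
  have "orient s * \<phi> k \<le> orient s * \<phi> l" if "k \<le> l" for k l
  proof -
    \<comment> \<open>translating by \<open>\<bar>k\<bar>\<close> periods moves both arguments to where \<open>\<phi>\<close> agrees with \<open>\<psi>\<close>\<close>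
    have "\<bar>k\<bar> \<le> \<bar>k\<bar> * ?M"
      by (simp add: algebra_simps)
    then have "0 \<le> k + \<bar>k\<bar> * ?M"
      by linarith
    with seg[of "k + \<bar>k\<bar> * ?M" "l + \<bar>k\<bar> * ?M"] that
    have "orient s * \<phi> (k + \<bar>k\<bar> * ?M) \<le> orient s * \<phi> (l + \<bar>k\<bar> * ?M)"
      by (simp add: \<phi>_nonneg)
    then show ?thesis
      unfolding periodic_add_mult[of \<phi>, OF \<phi>_per] by (simp add: distrib_left)
  qed
  with \<phi>_per have lift: "cyc_lift m n s \<phi>"
    by (simp add: cyc_lift_def)
  note G = zplus_functor_cyc_ftor[OF lift]
  have "F = cyc_ftor m n \<phi>"
    using zplus_functor_extensional[OF F] zplus_functor_extensional[OF G] seg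
    by (intro cyc_functor_eqI[of F m])
      (simp_all add: on_obj_cyc_ftor[OF lift] on_arr_cyc_ftor[OF lift] \<phi>_nonneg \<psi>(2))
  with lift show thesis
    by (rule that)
qed

lemma cyc_lift_eqI:
  assumes \<phi>: "cyc_lift m n s \<phi>" and \<psi>: "cyc_lift m n s \<psi>"
    and eq: "\<And>i. 0 \<le> i \<Longrightarrow> i \<le> int m \<Longrightarrow> \<psi> i = \<phi> i + d"
  shows "\<psi> k = \<phi> k + d"
proof -
  let ?i = "k mod (int m + 1)" and ?c = "k div (int m + 1)"
  have k: "k = ?i + ?c * (int m + 1)"
    by (simp only: mod_div_mult_eq)
  have "?i \<le> int m"
    using pos_mod_bound[of "int m + 1" k] by linarith
  then have "\<psi> ?i = \<phi> ?i + d"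
    by (simp add: eq)
  then have "\<psi> (?i + ?c * (int m + 1)) = \<phi> (?i + ?c * (int m + 1)) + d"
    by (simp only: cyc_lift_shift[OF \<phi>] cyc_lift_shift[OF \<psi>])
  then show ?thesis
    by (simp only: flip: k)
qed

lemma int_span_commute: "int_span n k l = int_span n l k"
  by (simp add: int_span_def min.commute max.commute)

lemma on_arr_cyc_ftor_span:
  assumes "cyc_lift m n s \<phi>"
  shows "on_arr (cyc_ftor m n \<phi>) (int_span m k l) = int_span n (\<phi> k) (\<phi> l)"
proof (cases "k \<le> l")
  case True
  with assms show ?thesis
    by (simp add: int_span_def[of m] on_arr_cyc_ftor)
next
  case False
  with assms show ?thesis
    by (simp add: int_span_def[of m] on_arr_cyc_ftor int_span_commute)
qed

lemma cyc_ftor_eqI: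
  assumes \<phi>: "cyc_lift m n s \<phi>" and \<psi>: "cyc_lift m n s \<psi>"
    and eq: "\<And>k. \<psi> k = \<phi> k + c * (int n + 1)"
  shows "cyc_ftor m n \<phi> = cyc_ftor m n \<psi>"
  using zplus_functor_extensional[OF zplus_functor_cyc_ftor[OF \<phi>]]
    zplus_functor_extensional[OF zplus_functor_cyc_ftor[OF \<psi>]]
  by (intro cyc_functor_eqI[of _ m])
    (simp_all only: on_obj_cyc_ftor[OF \<phi>] on_obj_cyc_ftor[OF \<psi>] on_arr_cyc_ftor[OF \<phi>]
      on_arr_cyc_ftor[OF \<psi>] eq int_point_shift int_span_shift)

text \<open>The image of the point \<open>0\<close> determines \<open>\<phi> 0\<close> up to a multiple of \<open>n + 1\<close>, and given \<open>\<phi> 0\<close> the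
  images of the arrows from \<open>0\<close> to \<open>i \<le> m\<close> determine \<open>\<phi>\<close> on one period.\<close>

lemma cyc_ftor_eqE:
  assumes \<phi>: "cyc_lift m n s \<phi>" and \<psi>: "cyc_lift m n s \<psi>"
    and obj: "on_obj (cyc_ftor m n \<phi>) (int_point m 0) = on_obj (cyc_ftor m n \<psi>) (int_point m 0)"
    and arr: "\<And>i. 0 \<le> i \<Longrightarrow> i \<le> int m \<Longrightarrow>
      on_arr (cyc_ftor m n \<phi>) (int_segment m 0 i) = on_arr (cyc_ftor m n \<psi>) (int_segment m 0 i)"
  obtains c where "\<And>k. \<psi> k = \<phi> k + c * (int n + 1)"
proof -
  have "int_point n (\<psi> 0) = int_point n (\<phi> 0)"
    using obj by (simp add: on_obj_cyc_ftor[OF \<phi>] on_obj_cyc_ftor[OF \<psi>])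
  then obtain c where c: "\<psi> 0 = \<phi> 0 + c * (int n + 1)"
    by (rule int_point_eqE)
  have "\<psi> i = \<phi> i + c * (int n + 1)" if i: "0 \<le> i" "i \<le> int m" for i
  proof -
    have "int_span n (\<psi> 0) (\<psi> i) = int_span n (\<phi> 0) (\<phi> i)"
      using arr[OF i] i by (simp add: on_arr_cyc_ftor[OF \<phi>] on_arr_cyc_ftor[OF \<psi>])
    also have "\<dots> = int_span n (\<psi> 0) (\<phi> i + c * (int n + 1))"
      by (simp only: c int_span_shift)
    finally show ?thesis
      using cyc_lift_mono[OF \<phi> i(1)] cyc_lift_mono[OF \<psi> i(1)] c
      by (intro int_span_inj[of s "\<psi> 0" _ _ n]) (auto simp: distrib_left)
  qed
  then have "\<psi> k = \<phi> k + c * (int n + 1)" for k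
    using \<phi> \<psi> by (rule cyc_lift_eqI[rotated 2])
  then show thesis
    by (rule that)
qed

lemma cyc_lift_id: "cyc_lift n n False (\<lambda>k. k)"
  by (simp add: cyc_lift_def)

lemma cyc_lift_comp:
  assumes \<psi>: "cyc_lift l m t \<psi>" and \<phi>: "cyc_lift m n s \<phi>"
  shows "cyc_lift l n (s \<noteq> t) (\<lambda>k. \<phi> (\<psi> k))"
proof -
  have "\<phi> (\<psi> (k + (int l + 1))) = \<phi> (\<psi> k) + orient (s \<noteq> t) * (int n + 1)" for k
    using \<psi> cyc_lift_shift[OF \<phi>, of "\<psi> k" "orient t"]
    by (cases s; cases t) (simp_all add: cyc_lift_def)
  moreover have "orient (s \<noteq> t) * \<phi> (\<psi> j) \<le> orient (s \<noteq> t) * \<phi> (\<psi> k)" if "j \<le> k" for j k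
    using cyc_lift_mono[OF \<psi> that] cyc_lift_mono[OF \<phi>, of "\<psi> j" "\<psi> k"]
      cyc_lift_mono[OF \<phi>, of "\<psi> k" "\<psi> j"]
    by (cases s; cases t) simp_all
  ultimately show ?thesis
    by (simp add: cyc_lift_def)
qed

lemma functor_comp_cyc_ftor:
  assumes \<psi>: "cyc_lift l m t \<psi>" and \<phi>: "cyc_lift m n s \<phi>"
  shows "functor_comp (cyc l) (cyc_ftor m n \<phi>) (cyc_ftor l m \<psi>) = cyc_ftor l n (\<lambda>k. \<phi> (\<psi> k))"
proof (rule cyc_functor_eqI[of _ l])
  note \<phi>\<psi> = cyc_lift_comp[OF \<psi> \<phi>]
  show "on_obj (cyc_ftor l n (\<lambda>k. \<phi> (\<psi> k))) \<in> extensional (Obj (cyc l))"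
    "on_arr (cyc_ftor l n (\<lambda>k. \<phi> (\<psi> k))) \<in> extensional (Arr (cyc l))"
    using zplus_functor_extensional[OF zplus_functor_cyc_ftor[OF \<phi>\<psi>]] .
  show "on_obj (functor_comp (cyc l) (cyc_ftor m n \<phi>) (cyc_ftor l m \<psi>)) (int_point l k)
      = on_obj (cyc_ftor l n (\<lambda>k. \<phi> (\<psi> k))) (int_point l k)" for k
    by (simp add: functor_comp_def compose_eq on_obj_cyc_ftor[OF \<phi>] on_obj_cyc_ftor[OF \<psi>]
        on_obj_cyc_ftor[OF \<phi>\<psi>])
  show "on_arr (functor_comp (cyc l) (cyc_ftor m n \<phi>) (cyc_ftor l m \<psi>)) (int_segment l j k)
      = on_arr (cyc_ftor l n (\<lambda>k. \<phi> (\<psi> k))) (int_segment l j k)" if "j \<le> k" for j k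
  proof -
    have "int_segment l j k \<in> Arr (cyc l)"
      using that by (auto simp: Arr_cyc)
    then show ?thesis
      using that by (simp add: functor_comp_def compose_eq on_arr_cyc_ftor_span[OF \<phi>]
          on_arr_cyc_ftor[OF \<psi>] on_arr_cyc_ftor[OF \<phi>\<psi>])
  qed
qed (simp_all add: functor_comp_def)

lemma functor_id_cyc: "functor_id (cyc n) = cyc_ftor n n (\<lambda>k. k)"
proof (rule cyc_functor_eqI[of _ n])
  show "on_obj (cyc_ftor n n (\<lambda>k. k)) \<in> extensional (Obj (cyc n))"
    "on_arr (cyc_ftor n n (\<lambda>k. k)) \<in> extensional (Arr (cyc n))"
    using zplus_functor_extensional[OF zplus_functor_cyc_ftor[OF cyc_lift_id]] .
  show "on_obj (functor_id (cyc n)) (int_point n k) = on_obj (cyc_ftor n n (\<lambda>k. k)) (int_point n k)" for k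
    by (simp add: functor_id_def on_obj_cyc_ftor[OF cyc_lift_id])
  show "on_arr (functor_id (cyc n)) (int_segment n k l) = on_arr (cyc_ftor n n (\<lambda>k. k)) (int_segment n k l)"
    if "k \<le> l" for k l
  proof -
    have "int_segment n k l \<in> Arr (cyc n)"
      using that by (auto simp: Arr_cyc)
    then show ?thesis
      using that by (simp add: functor_id_def on_arr_cyc_ftor[OF cyc_lift_id] int_span_def)
  qed
qed (simp_all add: functor_id_def)

section \<open>The category of covariant and contravariant functors\<close>

text \<open>The arrow of \<open>DeltaD\<close> represented by \<open>\<phi>\<close>; the tag keeps the two variances apart.\<close>

definition dihedral_map :: "nat \<Rightarrow> nat \<Rightarrow> bool \<Rightarrow> (int \<Rightarrow> int) \<Rightarrow> nat \<times> (cyc_functor + cyc_functor) \<times> nat" where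
  "dihedral_map m n s \<phi> = (m, (if s then Inr else Inl) (cyc_ftor m n \<phi>), n)"

lemma Hom_DeltaD: "Hom DeltaD m n = {dihedral_map m n s \<phi> | s \<phi>. cyc_lift m n s \<phi>}"
proof -
  have hom: "Hom DeltaD m n = {(m, T, n) | T. T \<in> cyc_maps m n}"
    by (auto simp: Hom_def DeltaD_def)
  show ?thesis
  proof (intro equalityI subsetI)
    fix h assume "h \<in> Hom DeltaD m n"
    then obtain T where T: "T \<in> cyc_maps m n" "h = (m, T, n)"
      by (auto simp: hom)
    obtain s F where F: "zplus_functor (cyc m) (cyc_target s n) F" and h: "h = (m, (if s then Inr else Inl) F, n)"
    proof (cases T)
      case (Inl F)
      with T that[of False F] show thesis
        by (auto simp: cyc_maps_def cyc_target_def)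
    next
      case (Inr F)
      with T that[of True F] show thesis
        by (auto simp: cyc_maps_def cyc_target_def)
    qed
    from F obtain \<phi> where \<phi>: "cyc_lift m n s \<phi>" "F = cyc_ftor m n \<phi>"
      by (rule zplus_functor_lift)
    then have "h = dihedral_map m n s \<phi>"
      by (simp add: h dihedral_map_def)
    with \<phi>(1) show "h \<in> {dihedral_map m n s \<phi> | s \<phi>. cyc_lift m n s \<phi>}"
      by blast
  next
    fix h assume "h \<in> {dihedral_map m n s \<phi> | s \<phi>. cyc_lift m n s \<phi>}"
    then obtain s \<phi> where h: "h = dihedral_map m n s \<phi>" and "cyc_lift m n s \<phi>"
      by blast
    then have "zplus_functor (cyc m) (cyc_target s n) (cyc_ftor m n \<phi>)"
      by (intro zplus_functor_cyc_ftor)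
    then show "h \<in> Hom DeltaD m n"
      by (cases s) (simp_all add: h hom cyc_maps_def cyc_target_def dihedral_map_def InlI InrI)
  qed
qed

lemma dihedral_map_in_Hom: "cyc_lift m n s \<phi> \<Longrightarrow> dihedral_map m n s \<phi> \<in> Hom DeltaD m n"
  by (auto simp: Hom_DeltaD)

lemma dihedral_map_eq_iff:
  assumes \<phi>: "cyc_lift m n s \<phi>" and \<psi>: "cyc_lift m n t \<psi>"
  shows "dihedral_map m n s \<phi> = dihedral_map m n t \<psi> \<longleftrightarrow> s = t \<and> (\<exists>c. \<forall>k. \<psi> k = \<phi> k + c * (int n + 1))"
proof
  assume eq: "dihedral_map m n s \<phi> = dihedral_map m n t \<psi>"
  then have st: "s = t"
    by (auto simp: dihedral_map_def split: if_splits)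
  with eq have "cyc_ftor m n \<phi> = cyc_ftor m n \<psi>"
    by (auto simp: dihedral_map_def split: if_splits)
  with \<phi> \<psi> obtain c where "\<And>k. \<psi> k = \<phi> k + c * (int n + 1)"
    unfolding st by (metis cyc_ftor_eqE)
  with st show "s = t \<and> (\<exists>c. \<forall>k. \<psi> k = \<phi> k + c * (int n + 1))"
    by blast
next
  assume "s = t \<and> (\<exists>c. \<forall>k. \<psi> k = \<phi> k + c * (int n + 1))"
  then obtain c where st: "s = t" and c: "\<And>k. \<psi> k = \<phi> k + c * (int n + 1)"
    by blast
  have "cyc_ftor m n \<phi> = cyc_ftor m n \<psi>"
    using \<phi> \<psi>[folded st] c by (rule cyc_ftor_eqI)
  with st show "dihedral_map m n s \<phi> = dihedral_map m n t \<psi>"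
    by (simp add: dihedral_map_def)
qed

lemma Comp_dihedral_map:
  assumes "cyc_lift l m t \<psi>" "cyc_lift m n s \<phi>"
  shows "Comp DeltaD (dihedral_map m n s \<phi>) (dihedral_map l m t \<psi>)
    = dihedral_map l n (s \<noteq> t) (\<lambda>k. \<phi> (\<psi> k))"
  by (simp add: DeltaD_def dihedral_map_def functor_comp_cyc_ftor[OF assms])

lemma Idt_DeltaD: "Idt DeltaD n = dihedral_map n n False (\<lambda>k. k)"
  by (simp add: DeltaD_def dihedral_map_def functor_id_cyc)

lemma category_DeltaD: "category DeltaD"
proof unfold_locales
  fix f assume "f \<in> Arr DeltaD"
  then show "Dom DeltaD f \<in> Obj DeltaD" "Cod DeltaD f \<in> Obj DeltaD"
    by (simp_all add: DeltaD_def)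
next
  fix n assume "n \<in> Obj DeltaD"
  show "Idt DeltaD n \<in> Hom DeltaD n n"
    by (simp add: Idt_DeltaD dihedral_map_in_Hom cyc_lift_id)
next
  fix f g l m n assume "f \<in> Hom DeltaD l m" "g \<in> Hom DeltaD m n"
  then obtain s t \<phi> \<psi> where "cyc_lift l m t \<psi>" "f = dihedral_map l m t \<psi>"
    "cyc_lift m n s \<phi>" "g = dihedral_map m n s \<phi>"
    by (auto simp: Hom_DeltaD)
  then show "Comp DeltaD g f \<in> Hom DeltaD l n"
    using dihedral_map_in_Hom[OF cyc_lift_comp, of l m t \<psi> n s \<phi>] by (simp only: Comp_dihedral_map)
next
  fix f m n assume "f \<in> Hom DeltaD m n"
  then show "Comp DeltaD (Idt DeltaD n) f = f" "Comp DeltaD f (Idt DeltaD m) = f"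
    by (auto simp: Hom_DeltaD Idt_DeltaD Comp_dihedral_map[OF _ cyc_lift_id]
        Comp_dihedral_map[OF cyc_lift_id])
next
  fix f g h k l m n
  assume "f \<in> Hom DeltaD k l" "g \<in> Hom DeltaD l m" "h \<in> Hom DeltaD m n"
  then obtain r s t \<phi> \<psi> \<theta> where "cyc_lift k l r \<phi>" "cyc_lift l m s \<psi>" "cyc_lift m n t \<theta>"
    "f = dihedral_map k l r \<phi>" "g = dihedral_map l m s \<psi>" "h = dihedral_map m n t \<theta>"
    by (auto simp: Hom_DeltaD)
  moreover from this have "cyc_lift k m (s \<noteq> r) (\<lambda>i. \<psi> (\<phi> i))" "cyc_lift l n (t \<noteq> s) (\<lambda>i. \<theta> (\<psi> i))"
    by (blast intro: cyc_lift_comp)+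
  moreover have "((t \<noteq> s) \<noteq> r) = (t \<noteq> (s \<noteq> r))"
    by blast
  ultimately show "Comp DeltaD (Comp DeltaD h g) f = Comp DeltaD h (Comp DeltaD g f)"
    by (simp only: Comp_dihedral_map)
qed

section \<open>The simplex category inside the dihedral category\<close>

text \<open>The extension of \<open>f : [m] \<rightarrow> [n]\<close> to the integers that represents the functor induced by \<open>f\<close>.\<close>

definition periodic_extension :: "nat \<Rightarrow> nat \<Rightarrow> (nat \<Rightarrow> nat) \<Rightarrow> int \<Rightarrow> int" where
  "periodic_extension m n f k = int (f (nat (k mod (int m + 1)))) + (k div (int m + 1)) * (int n + 1)"

lemma Hom_Delta: "Hom Delta m n = {(m, f, n) | f. f \<in> {0..m} \<rightarrow>\<^sub>E {0..n} \<and> mono_on {0..m} f}"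
  by (auto simp: Hom_def Delta_def)

lemma Arr_Delta: "(m, f, n) \<in> Arr Delta \<longleftrightarrow> f \<in> {0..m} \<rightarrow>\<^sub>E {0..n} \<and> mono_on {0..m} f"
  by (simp add: Delta_def)

lemma periodic_extension_int: "i \<le> m \<Longrightarrow> periodic_extension m n f (int i) = int (f i)"
  by (simp add: periodic_extension_def mod_pos_pos_trivial div_pos_pos_trivial)

lemma cyc_lift_periodic_extension:
  assumes "(m, f, n) \<in> Arr Delta"
  shows "cyc_lift m n False (periodic_extension m n f)"
proof -
  have range: "nat (k mod (int m + 1)) \<in> {0..m}" for k
    using pos_mod_bound[of "int m + 1" k] by simp
  have f: "f i \<le> n" if "i \<in> {0..m}" for i
    using assms that by (auto simp: Arr_Delta)
  have "periodic_extension m n f k \<le> periodic_extension m n f l" if "k \<le> l" for k l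
  proof (cases "k div (int m + 1) = l div (int m + 1)")
    case True
    moreover have "k mod (int m + 1) \<le> l mod (int m + 1)"
      using that True by (simp flip: minus_div_mult_eq_mod)
    then have "f (nat (k mod (int m + 1))) \<le> f (nat (l mod (int m + 1)))"
      using assms range by (intro mono_onD[of "{0..m}" f]) (auto simp: Arr_Delta nat_mono)
    ultimately show ?thesis
      by (simp add: periodic_extension_def)
  next
    case False
    have "k div (int m + 1) \<le> l div (int m + 1)"
      using that by (simp add: zdiv_mono1)
    with False have "k div (int m + 1) + 1 \<le> l div (int m + 1)"
      by simp
    then have "(k div (int m + 1) + 1) * (int n + 1) \<le> (l div (int m + 1)) * (int n + 1)"
      by (simp add: mult_right_mono)
    moreover have "int (f (nat (k mod (int m + 1)))) \<le> int n"
      using f[OF range] by simp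
    ultimately show ?thesis
      by (simp add: periodic_extension_def distrib_right)
  qed
  moreover have "periodic_extension m n f (k + (int m + 1)) = periodic_extension m n f k + (int n + 1)" for k
  proof -
    have "(k + (int m + 1)) mod (int m + 1) = k mod (int m + 1)"
      "(k + (int m + 1)) div (int m + 1) = k div (int m + 1) + 1"
      by simp_all
    then show ?thesis
      unfolding periodic_extension_def by (simp only:) (simp add: algebra_simps)
  qed
  ultimately show ?thesis
    by (simp add: cyc_lift_def)
qed

lemma periodic_extension_eqI:
  assumes "(m, f, n) \<in> Arr Delta" "cyc_lift m n False \<psi>"
    and "\<And>i. i \<le> m \<Longrightarrow> \<psi> (int i) = int (f i) + d"
  shows "\<psi> k = periodic_extension m n f k + d"
proof (rule cyc_lift_eqI[OF cyc_lift_periodic_extension[OF assms(1)] assms(2)])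
  fix i assume "0 \<le> i" "i \<le> int m"
  then show "\<psi> i = periodic_extension m n f i + d"
    using assms(3)[of "nat i"] periodic_extension_int[of "nat i" m n f] by simp
qed

text \<open>The condition on the generator \<open>m \<rightarrow> 0\<close> holds because in integer coordinates it is the arrow from
  \<open>m\<close> to \<open>m + 1\<close>, and \<open>m + 1\<close> is sent to \<open>f 0 + n + 1\<close>; on the way from \<open>f m\<close> to this integer lie
  \<open>n\<close> and \<open>n + 1\<close>.\<close>

lemma is_cyc_extension_cyc_ftor:
  assumes f: "(m, f, n) \<in> Arr Delta"
  shows "is_cyc_extension m n f (cyc_ftor m n (periodic_extension m n f))"
proof -
  let ?\<phi> = "periodic_extension m n f"
  note lift = cyc_lift_periodic_extension[OF f]
  have fm: "f m \<le> n" and mono: "\<And>i j. i \<le> j \<Longrightarrow> j \<le> m \<Longrightarrow> f i \<le> f j"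
    using f by (auto simp: Arr_Delta mono_on_def)
  have "?\<phi> (0 + 1 * (int m + 1)) = int (f 0) + int n + 1"
    unfolding cyc_lift_shift[OF lift] using periodic_extension_int[of 0 m n f] by simp
  then have top: "?\<phi> (int m + 1) = int (f 0) + int n + 1"
    by simp
  have "on_arr (cyc_ftor m n ?\<phi>) (wrap_arrow m) = int_segment n (int (f m)) (int (f 0) + int n + 1)"
    using fm by (simp add: wrap_arrow_eq on_arr_cyc_ftor[OF lift] periodic_extension_int top int_span_def)
  also have "\<dots> = Comp (cyc n) (int_segment n (int n + 1) (int (f 0) + int n + 1)) (int_segment n (int (f m)) (int n + 1))"
    using fm by (subst Comp_int_segment) auto
  also have "int_segment n (int n + 1) (int (f 0) + int n + 1) = order_arrow n 0 (f 0)"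
    using int_segment_shift[of 0 "int (f 0)" n 1] by (simp add: order_arrow_eq add.assoc)
  also have "int_segment n (int (f m)) (int n + 1) = Comp (cyc n) (wrap_arrow n) (order_arrow n (f m) n)"
    using fm by (simp add: wrap_arrow_eq order_arrow_eq Comp_int_segment)
  finally show ?thesis
    using zplus_functor_cyc_ftor[OF lift] mono
    by (auto simp: is_cyc_extension_def cyc_target_def cyc_point_eq order_arrow_eq
        on_obj_cyc_ftor[OF lift] on_arr_cyc_ftor[OF lift] periodic_extension_int int_span_def)
qed

lemma is_cyc_extension_unique:
  assumes f: "(m, f, n) \<in> Arr Delta" and F: "is_cyc_extension m n f F"
  shows "F = cyc_ftor m n (periodic_extension m n f)"
proof -
  let ?G = "cyc_ftor m n (periodic_extension m n f)"
  note lift = cyc_lift_periodic_extension[OF f] and G = is_cyc_extension_cyc_ftor[OF f]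
  have "zplus_functor (cyc m) (cyc_target False n) F"
    using F by (simp add: is_cyc_extension_def cyc_target_def)
  then obtain \<phi> where \<phi>: "cyc_lift m n False \<phi>" "F = cyc_ftor m n \<phi>"
    by (rule zplus_functor_lift)
  have "on_obj F (cyc_point m 0) = on_obj ?G (cyc_point m 0)"
    using F G by (simp add: is_cyc_extension_def)
  then have obj: "on_obj ?G (int_point m 0) = on_obj F (int_point m 0)"
    by (simp add: cyc_point_eq)
  have arr: "on_arr ?G (int_segment m 0 i) = on_arr F (int_segment m 0 i)" if "0 \<le> i" "i \<le> int m" for i
  proof -
    have "on_arr ?G (order_arrow m 0 (nat i)) = on_arr F (order_arrow m 0 (nat i))"
      using F G that by (simp add: is_cyc_extension_def)
    then show ?thesis
      using that by (simp add: order_arrow_eq)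
  qed
  show ?thesis
    using cyc_ftor_eqE[OF lift \<phi>(1) obj[unfolded \<phi>(2)] arr[unfolded \<phi>(2)]] cyc_ftor_eqI[OF lift \<phi>(1)]
    by (metis \<phi>(2))
qed

lemma cyc_extension_eq:
  "(m, f, n) \<in> Arr Delta \<Longrightarrow> cyc_extension m n f = cyc_ftor m n (periodic_extension m n f)"
  unfolding cyc_extension_def
  by (rule the_equality) (auto intro: is_cyc_extension_cyc_ftor is_cyc_extension_unique)

lemma on_arr_Delta_to_DeltaD:
  assumes "(m, f, n) \<in> Arr Delta"
  shows "on_arr Delta_to_DeltaD (m, f, n) = dihedral_map m n False (periodic_extension m n f)"
  using assms by (simp add: Delta_to_DeltaD_def cyc_extension_eq dihedral_map_def)

lemma category_Delta: "category Delta"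
proof unfold_locales
  fix f assume "f \<in> Arr Delta"
  then show "Dom Delta f \<in> Obj Delta" "Cod Delta f \<in> Obj Delta"
    by (simp_all add: Delta_def)
next
  fix n assume "n \<in> Obj Delta"
  show "Idt Delta n \<in> Hom Delta n n"
    unfolding Hom_Delta by (auto simp: Delta_def mono_on_def)
next
  fix f' g' l m n assume "f' \<in> Hom Delta l m" "g' \<in> Hom Delta m n"
  then obtain f g where f: "f' = (l, f, m)" "f \<in> {0..l} \<rightarrow>\<^sub>E {0..m}" "mono_on {0..l} f"
      and g: "g' = (m, g, n)" "g \<in> {0..m} \<rightarrow>\<^sub>E {0..n}" "mono_on {0..m} g"
    unfolding Hom_Delta by blast
  have "compose {0..l} g f \<in> {0..l} \<rightarrow>\<^sub>E {0..n}"
    using f(2) g(2) by (fastforce simp: compose_def)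
  moreover have "mono_on {0..l} (compose {0..l} g f)"
  proof (rule mono_onI)
    fix i j assume ij: "i \<in> {0..l}" "j \<in> {0..l}" "i \<le> j"
    then have "g (f i) \<le> g (f j)"
      using f(2) by (intro mono_onD[OF g(3)] mono_onD[OF f(3)]) auto
    then show "compose {0..l} g f i \<le> compose {0..l} g f j"
      using ij by (simp add: compose_def)
  qed
  moreover have "Comp Delta g' f' = (l, compose {0..l} g f, n)"
    by (simp add: Delta_def f g)
  ultimately show "Comp Delta g' f' \<in> Hom Delta l n"
    unfolding Hom_Delta by blast
next
  fix f' m n assume "f' \<in> Hom Delta m n"
  then obtain f where f: "f' = (m, f, n)" "f \<in> {0..m} \<rightarrow>\<^sub>E {0..n}"
    unfolding Hom_Delta by blast
  have "compose {0..m} (\<lambda>i\<in>{0..n}. i) f = f" "compose {0..m} f (\<lambda>i\<in>{0..m}. i) = f"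
    using f(2) by (auto simp: PiE_def intro!: extensionalityI[of _ "{0..m}"] simp: compose_def Pi_def)
  then show "Comp Delta (Idt Delta n) f' = f'" "Comp Delta f' (Idt Delta m) = f'"
    by (simp_all add: Delta_def f(1))
next
  fix f' g' h' k l m n
  assume "f' \<in> Hom Delta k l" "g' \<in> Hom Delta l m" "h' \<in> Hom Delta m n"
  then obtain f g h where f: "f' = (k, f, l)" "f \<in> {0..k} \<rightarrow>\<^sub>E {0..l}"
      and gh: "g' = (l, g, m)" "h' = (m, h, n)"
    unfolding Hom_Delta by blast
  have "compose {0..k} (compose {0..l} h g) f = compose {0..k} h (compose {0..k} g f)"
    using f(2) by (intro compose_assoc[symmetric]) auto
  then show "Comp Delta (Comp Delta h' g') f' = Comp Delta h' (Comp Delta g' f')"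
    by (simp add: Delta_def f(1) gh)
qed

lemma cat_functor_Delta_to_DeltaD: "cat_functor Delta DeltaD Delta_to_DeltaD"
proof -
  interpret D: category Delta by (rule category_Delta)
  interpret DD: category DeltaD by (rule category_DeltaD)
  have obj: "on_obj Delta_to_DeltaD n = n" for n
    by (simp add: Delta_to_DeltaD_def)
  show ?thesis
  proof unfold_locales
    show "on_obj Delta_to_DeltaD \<in> Obj Delta \<rightarrow>\<^sub>E Obj DeltaD"
      by (simp add: Delta_def DeltaD_def)
    show "on_arr Delta_to_DeltaD \<in> extensional (Arr Delta)"
      by (simp add: Delta_to_DeltaD_def)
  next
    fix f m n assume "f \<in> Hom Delta m n"
    then show "on_arr Delta_to_DeltaD f \<in> Hom DeltaD (on_obj Delta_to_DeltaD m) (on_obj Delta_to_DeltaD n)"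
      by (auto simp: Hom_Delta obj on_arr_Delta_to_DeltaD Arr_Delta
          intro!: dihedral_map_in_Hom cyc_lift_periodic_extension)
  next
    fix n
    have id: "Idt Delta n = (n, \<lambda>i\<in>{0..n}. i, n)" and arr: "(n, \<lambda>i\<in>{0..n}. i, n) \<in> Arr Delta"
      by (auto simp: Delta_def mono_on_def)
    have "k = periodic_extension n n (\<lambda>i\<in>{0..n}. i) k + 0" for k
      by (rule periodic_extension_eqI[OF arr, of "\<lambda>k. k"]) (auto simp: cyc_lift_id)
    then have "periodic_extension n n (\<lambda>i\<in>{0..n}. i) = (\<lambda>k. k)"
      by auto
    then show "on_arr Delta_to_DeltaD (Idt Delta n) = Idt DeltaD (on_obj Delta_to_DeltaD n)"
      by (simp add: id on_arr_Delta_to_DeltaD[OF arr] Idt_DeltaD obj)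
  next
    fix f' g' l m n assume f': "f' \<in> Hom Delta l m" and g': "g' \<in> Hom Delta m n"
    then obtain f g where f: "f' = (l, f, m)" "(l, f, m) \<in> Arr Delta"
        and g: "g' = (m, g, n)" "(m, g, n) \<in> Arr Delta"
      by (auto simp: Hom_Delta Arr_Delta)
    have comp: "Comp Delta g' f' = (l, compose {0..l} g f, n)"
      by (simp add: Delta_def f g)
    then have arr: "(l, compose {0..l} g f, n) \<in> Arr Delta"
      using D.comp_in[OF f' g'] by (simp add: Hom_def)
    note lifts = cyc_lift_periodic_extension[OF f(2)] cyc_lift_periodic_extension[OF g(2)]
    have "periodic_extension m n g (periodic_extension l m f k) = periodic_extension l n (compose {0..l} g f) k + 0" for k
    proof (rule periodic_extension_eqI[OF arr, of "\<lambda>k. periodic_extension m n g (periodic_extension l m f k)"])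
      show "cyc_lift l n False (\<lambda>k. periodic_extension m n g (periodic_extension l m f k))"
        using cyc_lift_comp[OF lifts] by simp
      show "periodic_extension m n g (periodic_extension l m f (int i)) = int (compose {0..l} g f i) + 0" if "i \<le> l" for i
      proof -
        have "f i \<le> m"
          using f(2) that by (auto simp: Arr_Delta)
        then show ?thesis
          using that by (simp add: periodic_extension_int compose_def)
      qed
    qed
    then have "periodic_extension l n (compose {0..l} g f) = (\<lambda>k. periodic_extension m n g (periodic_extension l m f k))"
      by auto
    then show "on_arr Delta_to_DeltaD (Comp Delta g' f')
        = Comp DeltaD (on_arr Delta_to_DeltaD g') (on_arr Delta_to_DeltaD f')"
      by (simp add: comp on_arr_Delta_to_DeltaD[OF arr])
        (simp add: f(1) g(1) on_arr_Delta_to_DeltaD[OF f(2)] on_arr_Delta_to_DeltaD[OF g(2)]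
          Comp_dihedral_map[OF lifts])
  qed
qed

text \<open>The translation by \<open>c * (n + 1)\<close> is trivial because \<open>f 0\<close> and \<open>g 0\<close> both lie in \<open>{0..n}\<close>.\<close>

lemma periodic_extension_inj:
  assumes f: "(m, f, n) \<in> Arr Delta" and g: "(m, g, n) \<in> Arr Delta"
    and eq: "\<And>k. periodic_extension m n g k = periodic_extension m n f k + c * (int n + 1)"
  shows "f = g"
proof -
  have fg: "int (g i) = int (f i) + c * (int n + 1)" if "i \<le> m" for i
    using eq[of "int i"] that by (simp add: periodic_extension_int)
  have "f 0 \<le> n" "g 0 \<le> n"
    using f g by (auto simp: Arr_Delta)
  with fg[of 0] have "\<bar>c * (int n + 1)\<bar> < int n + 1"
    by simp
  then have "\<bar>c\<bar> * (int n + 1) < 1 * (int n + 1)"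
    by (simp add: abs_mult)
  then have "c = 0"
    by (simp only: mult_less_cancel_right) auto
  with fg have "g i = f i" if "i \<in> {0..m}" for i
    using that by simp
  with f g show ?thesis
    by (intro extensionalityI[of f "{0..m}"]) (auto simp: Arr_Delta PiE_def)
qed

lemma inj_on_Delta_to_DeltaD: "inj_on (on_arr Delta_to_DeltaD) (Arr Delta)"
proof (rule inj_onI)
  fix x y assume xy: "x \<in> Arr Delta" "y \<in> Arr Delta" "on_arr Delta_to_DeltaD x = on_arr Delta_to_DeltaD y"
  obtain m f n m' g n' where x: "x = (m, f, n)" and y: "y = (m', g, n')"
    by (metis prod_cases3)
  note f = xy(1)[unfolded x] and g = xy(2)[unfolded y]
  have eq: "dihedral_map m n False (periodic_extension m n f) = dihedral_map m' n' False (periodic_extension m' n' g)"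
    using xy(3) by (simp add: x y on_arr_Delta_to_DeltaD[OF f] on_arr_Delta_to_DeltaD[OF g])
  then have mn: "m' = m" "n' = n"
    by (simp_all add: dihedral_map_def)
  note g = g[unfolded mn] and eq = eq[unfolded mn]
  show "x = y"
  proof -
    obtain c where "\<And>k. periodic_extension m n g k = periodic_extension m n f k + c * (int n + 1)"
      using eq dihedral_map_eq_iff[OF cyc_lift_periodic_extension[OF f] cyc_lift_periodic_extension[OF g]] by blast
    with f g have "f = g"
      by (rule periodic_extension_inj)
    then show ?thesis
      by (simp add: x y mn)
  qed
qed

section \<open>Dihedral groups as automorphism groups\<close>

text \<open>The rotation by \<open>a\<close> steps, preceded by the reflection \<open>k \<mapsto> - k\<close> if \<open>s\<close> holds.\<close>

definition dihedral_aut :: "nat \<Rightarrow> int \<Rightarrow> bool \<Rightarrow> nat \<times> (cyc_functor + cyc_functor) \<times> nat" where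
  "dihedral_aut n a s = dihedral_map n n s (\<lambda>k. a + orient s * k)"

lemma cyc_lift_affine: "cyc_lift n n s (\<lambda>k. a + orient s * k)"
  by (cases s) (simp_all add: cyc_lift_def)

lemma dihedral_aut_in_Hom: "dihedral_aut n a s \<in> Hom DeltaD n n"
  by (simp add: dihedral_aut_def dihedral_map_in_Hom cyc_lift_affine)

lemma Comp_dihedral_aut:
  "Comp DeltaD (dihedral_aut n a s) (dihedral_aut n b t) = dihedral_aut n (a + orient s * b) (s \<noteq> t)"
proof -
  have "(\<lambda>k. a + orient s * (b + orient t * k)) = (\<lambda>k. a + orient s * b + orient (s \<noteq> t) * k)"
    by (cases s; cases t) (auto simp: algebra_simps)
  then show ?thesis
    by (simp add: dihedral_aut_def Comp_dihedral_map[OF cyc_lift_affine cyc_lift_affine])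
qed

lemma dihedral_aut_eq_iff:
  "dihedral_aut n a s = dihedral_aut n b t \<longleftrightarrow> s = t \<and> a mod (int n + 1) = b mod (int n + 1)"
proof -
  have "(\<exists>c. \<forall>k. b + orient s * k = a + orient s * k + c * (int n + 1)) \<longleftrightarrow>
      (\<exists>c. b - a = (int n + 1) * c)"
    by (auto simp: algebra_simps)
  also have "\<dots> \<longleftrightarrow> b mod (int n + 1) = a mod (int n + 1)"
    by (simp add: mod_eq_dvd_iff dvd_def)
  also have "\<dots> \<longleftrightarrow> a mod (int n + 1) = b mod (int n + 1)"
    by (rule eq_commute)
  finally have "(\<exists>c. \<forall>k. b + orient s * k = a + orient s * k + c * (int n + 1)) \<longleftrightarrow>
      a mod (int n + 1) = b mod (int n + 1)" .
  then show ?thesis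
    unfolding dihedral_aut_def dihedral_map_eq_iff[OF cyc_lift_affine cyc_lift_affine] by blast
qed

lemma Idt_dihedral_aut: "Idt DeltaD n = dihedral_aut n 0 False"
  by (simp add: Idt_DeltaD dihedral_aut_def)

text \<open>By injectivity and monotonicity each step of \<open>orient s * \<phi>\<close> is at least one, so the difference
  \<open>\<theta> k = orient s * \<phi> k - k\<close> is non-decreasing. It is also periodic, hence constant.\<close>

lemma cyc_lift_inj_affine:
  assumes lift: "cyc_lift n n s \<phi>" and inj: "inj \<phi>"
  shows "\<phi> k = \<phi> 0 + orient s * k"
proof -
  define \<theta> where "\<theta> k = orient s * \<phi> k - k" for k
  have step: "\<theta> k \<le> \<theta> (k + 1)" for k
  proof -
    have "\<phi> (k + 1) \<noteq> \<phi> k"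
      using injD[OF inj, of "k + 1" k] by auto
    then show ?thesis
      using cyc_lift_mono[OF lift, of k "k + 1"] by (cases s) (auto simp: \<theta>_def)
  qed
  have mono: "\<theta> k \<le> \<theta> l" if "k \<le> l" for k l
    using that by (induction l rule: int_ge_induct) (auto intro: order_trans[OF _ step])
  have per: "\<theta> (k + c * (int n + 1)) = \<theta> k" for k c
    unfolding \<theta>_def cyc_lift_shift[OF lift] by (cases s) (simp_all add: algebra_simps)
  have bound: "\<bar>k\<bar> \<le> \<bar>k\<bar> * (int n + 1)"
    by (simp add: algebra_simps)
  have "\<theta> k \<le> \<theta> (0 + \<bar>k\<bar> * (int n + 1))"
    using bound by (intro mono) linarith
  moreover have "- (\<bar>k\<bar> * (int n + 1)) \<le> k"
    using bound by linarith
  then have "\<theta> (0 + (- \<bar>k\<bar>) * (int n + 1)) \<le> \<theta> k"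
    by (intro mono) simp
  ultimately have "\<theta> k = \<theta> 0"
    unfolding per by (rule antisym)
  then show ?thesis
    by (cases s) (simp_all add: \<theta>_def)
qed

text \<open>A left inverse of \<open>\<phi>\<close> up to translation makes \<open>\<phi>\<close> injective, hence affine.\<close>

lemma carrier_aut_group_DeltaD: "carrier (aut_group DeltaD n) = {dihedral_aut n a s | a s. True}"
proof -
  have units: "carrier (aut_group DeltaD n) = {x \<in> Hom DeltaD n n. \<exists>y\<in>Hom DeltaD n n.
      Comp DeltaD y x = Idt DeltaD n \<and> Comp DeltaD x y = Idt DeltaD n}"
    by (simp add: aut_group_def units_of_def Units_def)
  show ?thesis
  proof (intro equalityI subsetI)
    fix x assume "x \<in> carrier (aut_group DeltaD n)"
    then obtain y where x: "x \<in> Hom DeltaD n n" and y: "y \<in> Hom DeltaD n n"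
        and yx: "Comp DeltaD y x = Idt DeltaD n"
      unfolding units by blast
    obtain s \<phi> where \<phi>: "cyc_lift n n s \<phi>" "x = dihedral_map n n s \<phi>"
      using x by (auto simp: Hom_DeltaD)
    obtain t \<psi> where \<psi>: "cyc_lift n n t \<psi>" "y = dihedral_map n n t \<psi>"
      using y by (auto simp: Hom_DeltaD)
    have "dihedral_map n n False (\<lambda>k. k) = dihedral_map n n (t \<noteq> s) (\<lambda>k. \<psi> (\<phi> k))"
      using yx by (simp add: \<phi>(2) \<psi>(2) Comp_dihedral_map[OF \<phi>(1) \<psi>(1)] Idt_DeltaD)
    then obtain c where "\<And>k. \<psi> (\<phi> k) = k + c * (int n + 1)"
      using dihedral_map_eq_iff[OF cyc_lift_id cyc_lift_comp[OF \<phi>(1) \<psi>(1)]] by blast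
    then have "inj \<phi>"
      by (metis add_right_cancel injI)
    then have "\<phi> = (\<lambda>k. \<phi> 0 + orient s * k)"
      using cyc_lift_inj_affine[OF \<phi>(1)] by blast
    then have "x = dihedral_aut n (\<phi> 0) s"
      using \<phi>(2) by (simp add: dihedral_aut_def)
    then show "x \<in> {dihedral_aut n a s | a s. True}"
      by blast
  next
    fix x assume "x \<in> {dihedral_aut n a s | a s. True}"
    then obtain a s where x: "x = dihedral_aut n a s"
      by blast
    define y where "y = dihedral_aut n (- orient s * a) s"
    have "Comp DeltaD y x = Idt DeltaD n" "Comp DeltaD x y = Idt DeltaD n"
      by (cases s; simp add: x y_def Comp_dihedral_aut Idt_dihedral_aut)+
    then show "x \<in> carrier (aut_group DeltaD n)"
      unfolding units using dihedral_aut_in_Hom by (auto simp: x y_def)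
  qed
qed

lemma group_opposite_group:
  assumes "group G"
  shows "group (opposite_group G)"
proof -
  interpret group G by (rule assms)
  show ?thesis
  proof (rule groupI)
    fix x assume "x \<in> carrier (opposite_group G)"
    then show "\<exists>y\<in>carrier (opposite_group G). y \<otimes>\<^bsub>opposite_group G\<^esub> x = \<one>\<^bsub>opposite_group G\<^esub>"
      by (auto simp: opposite_group_def intro!: bexI[of _ "inv\<^bsub>G\<^esub> x"])
  qed (auto simp: opposite_group_def m_assoc)
qed

lemma group_dihedral_group:
  assumes "0 < n"
  shows "group (dihedral_group n)"
proof (rule groupI)
  fix x y z assume "x \<in> carrier (dihedral_group n)" "y \<in> carrier (dihedral_group n)"
    "z \<in> carrier (dihedral_group n)"
  obtain a s b t c u where xyz: "x = (a, s)" "y = (b, t)" "z = (c, u)"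
    by (metis surj_pair)
  show "x \<otimes>\<^bsub>dihedral_group n\<^esub> y \<otimes>\<^bsub>dihedral_group n\<^esub> z = x \<otimes>\<^bsub>dihedral_group n\<^esub> (y \<otimes>\<^bsub>dihedral_group n\<^esub> z)"
    by (cases s; cases t; simp add: xyz dihedral_group_def mod_simps; simp add: algebra_simps)
next
  fix x assume "x \<in> carrier (dihedral_group n)"
  then obtain a s where x: "x = (a, s)" "0 \<le> a" "a < int n"
    by (auto simp: dihedral_group_def)
  show "\<exists>y\<in>carrier (dihedral_group n). y \<otimes>\<^bsub>dihedral_group n\<^esub> x = \<one>\<^bsub>dihedral_group n\<^esub>"
    using x assms
    by (intro bexI[of _ "((if s then a else - a) mod int n, s)"])
      (auto simp: dihedral_group_def mod_simps)
qed (use assms in \<open>auto simp: dihedral_group_def\<close>)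

text \<open>Composition in \<open>aut_group\<close> is the product of the dihedral group, and inversion identifies a group
  with its opposite. So a dihedral element is sent to its inverse acting on the integers: a
  reflection to itself, a rotation to the opposite rotation.\<close>

lemma aut_group_DeltaD_iso: "aut_group DeltaD n \<cong> opposite_group (dihedral_group (n + 1))"
proof -
  let ?G = "opposite_group (dihedral_group (n + 1))" and ?H = "aut_group DeltaD n"
  let ?f = "\<lambda>(a, s). dihedral_aut n (- orient s * a) s"
  have carrier: "carrier ?G = {0..<int n + 1} \<times> UNIV"
    by (simp add: opposite_group_def dihedral_group_def add.commute)
  have mult: "(a, s) \<otimes>\<^bsub>?G\<^esub> (b, t) = ((b + orient t * a) mod (int n + 1), t \<noteq> s)" for a s b t
    by (simp add: opposite_group_def dihedral_group_def orient_def add.commute)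
  have mult_aut: "mult ?H = Comp DeltaD"
    by (simp add: aut_group_def units_of_def)
  have "?f \<in> iso ?G ?H"
  proof (rule isoI)
    show "?f \<in> hom ?G ?H"
    proof (rule homI)
      fix x assume "x \<in> carrier ?G"
      then show "?f x \<in> carrier ?H"
        by (auto simp: carrier_aut_group_DeltaD split: prod.split)
    next
      fix x y assume "x \<in> carrier ?G" "y \<in> carrier ?G"
      obtain a s b t where xy: "x = (a, s)" "y = (b, t)"
        by fastforce
      have "dihedral_aut n (- orient (t \<noteq> s) * ((b + orient t * a) mod (int n + 1))) (t \<noteq> s)
          = dihedral_aut n (- orient s * a + orient s * (- orient t * b)) (s \<noteq> t)"
        unfolding dihedral_aut_eq_iff
        by (cases s; cases t; simp add: mod_simps algebra_simps)
      then show "?f (x \<otimes>\<^bsub>?G\<^esub> y) = ?f x \<otimes>\<^bsub>?H\<^esub> ?f y"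
        by (simp only: xy mult mult_aut prod.case Comp_dihedral_aut)
    qed
    show "bij_betw ?f (carrier ?G) (carrier ?H)"
    proof (rule bij_betw_imageI)
      show "inj_on ?f (carrier ?G)"
      proof (rule inj_onI)
        fix x y assume xy: "x \<in> carrier ?G" "y \<in> carrier ?G" "?f x = ?f y"
        obtain a s b t where ab: "x = (a, s)" "y = (b, t)"
          by fastforce
        with xy(3) have st: "s = t" and "(- orient s * a) mod (int n + 1) = (- orient s * b) mod (int n + 1)"
          by (auto simp: dihedral_aut_eq_iff)
        then have "(- orient s * (- orient s * a)) mod (int n + 1) = (- orient s * (- orient s * b)) mod (int n + 1)"
          by (metis mod_mult_right_eq)
        then have "a mod (int n + 1) = b mod (int n + 1)"
          by (cases s) simp_all
        with xy(1,2)[unfolded carrier] st show "x = y"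
          by (simp add: ab)
      qed
      show "?f ` carrier ?G = carrier ?H"
      proof (intro equalityI subsetI)
        fix y assume "y \<in> ?f ` carrier ?G"
        then show "y \<in> carrier ?H"
          by (auto simp: carrier_aut_group_DeltaD)
      next
        fix y assume "y \<in> carrier ?H"
        then obtain a s where y: "y = dihedral_aut n a s"
          by (auto simp: carrier_aut_group_DeltaD)
        let ?x = "((- orient s * a) mod (int n + 1), s)"
        have "y = ?f ?x"
          by (cases s; simp add: y dihedral_aut_eq_iff mod_simps)
        moreover have "?x \<in> carrier ?G"
          unfolding carrier using pos_mod_bound[of "int n + 1" "- orient s * a"] by simp
        ultimately show "y \<in> ?f ` carrier ?G"
          by (rule image_eqI)
      qed
    qed
  qed
  then have "?G \<cong> ?H"
    by (auto simp: is_iso_def)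
  then show ?thesis
    by (rule group.iso_sym[rotated]) (simp add: group_opposite_group group_dihedral_group)
qed

section \<open>Unique factorization\<close>

text \<open>By periodicity \<open>\<phi>\<close> is unbounded in both directions, and it is monotone.\<close>

lemma cyc_lift_crossing:
  assumes lift: "cyc_lift m n False \<phi>"
  shows "\<exists>!a. \<phi> (a - 1) < 0 \<and> 0 \<le> \<phi> a"
proof (rule ex_ex1I)
  \<comment> \<open>after \<open>K\<close> periods \<open>\<phi>\<close> has changed by at least \<open>K\<close>, which exceeds \<open>\<bar>\<phi> 0\<bar>\<close>\<close>
  define K where "K = \<bar>\<phi> 0\<bar> + 1"
  have "\<bar>\<phi> 0\<bar> < K * 1"
    by (simp add: K_def)
  also have "\<dots> \<le> K * (int n + 1)"
    by (intro mult_left_mono) (simp_all add: K_def)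
  finally have bound: "\<bar>\<phi> 0\<bar> < K * (int n + 1)" .
  have neg: "\<phi> (- K * (int m + 1)) < 0"
    using cyc_lift_shift[OF lift, of 0 "- K"] bound by simp
  have pos: "0 \<le> \<phi> (K * (int m + 1))"
    using cyc_lift_shift[OF lift, of 0 K] bound by simp
  define P where "P j \<longleftrightarrow> 0 \<le> \<phi> (- K * (int m + 1) + int j)" for j
  define j where "j = (LEAST j. P j)"
  have "P (nat (2 * (K * (int m + 1))))"
  proof -
    have "0 \<le> K * (int m + 1)"
      by (simp add: K_def)
    then show ?thesis
      using pos by (simp add: P_def)
  qed
  then have j: "P j"
    unfolding j_def by (rule LeastI)
  have "j \<noteq> 0"
  proof
    assume "j = 0"
    with neg j show False
      by (simp add: P_def)
  qed
  then have "\<not> P (j - 1)"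
    unfolding j_def by (intro not_less_Least) simp
  with \<open>j \<noteq> 0\<close> j show "\<exists>a. \<phi> (a - 1) < 0 \<and> 0 \<le> \<phi> a"
    by (intro exI[of _ "- K * (int m + 1) + int j"]) (auto simp: P_def of_nat_diff algebra_simps)
next
  fix a b assume "\<phi> (a - 1) < 0 \<and> 0 \<le> \<phi> a" "\<phi> (b - 1) < 0 \<and> 0 \<le> \<phi> b"
  moreover have "\<phi> a \<le> \<phi> (b - 1)" if "a < b" for a b
    using cyc_lift_mono[OF lift, of a "b - 1"] that by simp
  ultimately show "a = b"
    by (metis linorder_neqE_linordered_idom not_le order_less_le_trans)
qed

text \<open>Let \<open>\<Phi>\<close> be \<open>\<phi>\<close> made covariant by the reflection \<open>k \<mapsto> - k\<close> where necessary. A factorization of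
  \<open>\<phi>\<close> is a translate \<open>k \<mapsto> \<Phi> (a + k)\<close> that is a \<open>periodic_extension\<close>. For a non-decreasing
  periodic map, taking \<open>{0..m}\<close> into \<open>{0..n}\<close> means being non-negative at \<open>0\<close> and at most \<open>n\<close> at
  \<open>m\<close>; by periodicity the latter says being negative at \<open>-1\<close>. So \<open>a\<close> must be the place
  where \<open>\<Phi>\<close> crosses zero.\<close>

lemma dihedral_map_factorization:
  assumes h: "h \<in> Hom DeltaD m n"
  shows "\<exists>!(f, g). f \<in> Hom Delta m n \<and> g \<in> carrier (aut_group DeltaD m) \<and>
    h = Comp DeltaD (on_arr Delta_to_DeltaD f) g"
proof -
  obtain s \<phi> where \<phi>: "cyc_lift m n s \<phi>" and h: "h = dihedral_map m n s \<phi>"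
    using h by (auto simp: Hom_DeltaD)
  define \<Phi> where "\<Phi> k = \<phi> (orient s * k)" for k
  have \<Phi>: "cyc_lift m n False \<Phi>"
    using cyc_lift_comp[OF cyc_lift_affine[of m s 0] \<phi>] by (simp add: \<Phi>_def[abs_def])
  have \<phi>_\<Phi>: "\<phi> k = \<Phi> (orient s * k)" for k
    by (cases s) (simp_all add: \<Phi>_def)
  obtain a where a: "\<Phi> (a - 1) < 0" "0 \<le> \<Phi> a"
    and a_unique: "\<And>b. \<Phi> (b - 1) < 0 \<Longrightarrow> 0 \<le> \<Phi> b \<Longrightarrow> b = a"
    using cyc_lift_crossing[OF \<Phi>] by metis
  define f where "f = (\<lambda>i\<in>{0..m}. nat (\<Phi> (a + int i)))"
  have mono: "\<Phi> j \<le> \<Phi> k" if "j \<le> k" for j k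
    using cyc_lift_mono[OF \<Phi> that] by simp
  have nonneg: "0 \<le> \<Phi> (a + int i)" for i
    using mono[of a "a + int i"] a by simp
  have "\<Phi> (a + int m) \<le> int n"
    using cyc_lift_shift[OF \<Phi>, of "a - 1" 1] a by simp
  then have le: "\<Phi> (a + int i) \<le> int n" if "i \<le> m" for i
    using mono[of "a + int i" "a + int m"] that by simp
  have f: "(m, f, n) \<in> Arr Delta"
    using le by (auto simp: Arr_Delta f_def mono_on_def nat_le_iff[of _ n] intro!: nat_mono mono)
  have ext_f: "periodic_extension m n f k = \<Phi> (a + k)" for k
  proof -
    have "cyc_lift m n False (\<lambda>k. \<Phi> (a + k))"
      using cyc_lift_comp[OF cyc_lift_affine[of m False a] \<Phi>] by simp
    then have "\<Phi> (a + k) = periodic_extension m n f k + 0"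
      using nonneg by (intro periodic_extension_eqI[OF f, of "\<lambda>k. \<Phi> (a + k)"]) (auto simp: f_def)
    then show ?thesis by simp
  qed
  have comp: "Comp DeltaD (on_arr Delta_to_DeltaD (m, f', n)) (dihedral_aut m b t)
      = dihedral_map m n t (\<lambda>k. periodic_extension m n f' (b + orient t * k))"
    and comp_lift: "cyc_lift m n t (\<lambda>k. periodic_extension m n f' (b + orient t * k))"
    if "(m, f', n) \<in> Arr Delta" for f' b t
    using Comp_dihedral_map[OF cyc_lift_affine cyc_lift_periodic_extension[OF that], of t b]
      cyc_lift_comp[OF cyc_lift_affine cyc_lift_periodic_extension[OF that], of t b]
    by (simp_all add: on_arr_Delta_to_DeltaD[OF that] dihedral_aut_def)
  show ?thesis
  proof (rule ex1I[of _ "((m, f, n), dihedral_aut m (- a) s)"])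
    have "(m, f, n) \<in> Hom Delta m n"
      using f by (simp add: Hom_Delta Arr_Delta)
    moreover have "dihedral_aut m (- a) s \<in> carrier (aut_group DeltaD m)"
      by (auto simp: carrier_aut_group_DeltaD)
    moreover have "h = Comp DeltaD (on_arr Delta_to_DeltaD (m, f, n)) (dihedral_aut m (- a) s)"
      by (simp add: comp[OF f] ext_f h flip: \<phi>_\<Phi>)
    ultimately show "case ((m, f, n), dihedral_aut m (- a) s) of (f, g) \<Rightarrow>
        f \<in> Hom Delta m n \<and> g \<in> carrier (aut_group DeltaD m) \<and> h = Comp DeltaD (on_arr Delta_to_DeltaD f) g"
      by simp
  next
    fix p assume "case p of (f, g) \<Rightarrow>
        f \<in> Hom Delta m n \<and> g \<in> carrier (aut_group DeltaD m) \<and> h = Comp DeltaD (on_arr Delta_to_DeltaD f) g"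
    then obtain f' b t where p: "p = ((m, f', n), dihedral_aut m b t)" and f': "(m, f', n) \<in> Arr Delta"
        and hp: "h = Comp DeltaD (on_arr Delta_to_DeltaD (m, f', n)) (dihedral_aut m b t)"
      by (auto simp: Hom_Delta carrier_aut_group_DeltaD Arr_Delta)
    from hp obtain c where t: "s = t" and
      c: "\<And>k. periodic_extension m n f' (b + orient t * k) = \<phi> k + c * (int n + 1)"
      unfolding comp[OF f'] h dihedral_map_eq_iff[OF \<phi> comp_lift[OF f']] by blast
    \<comment> \<open>the shift by \<open>c * (n + 1)\<close> in the target is absorbed as a shift by \<open>c\<close> periods in the source\<close>
    let ?a' = "- b + c * (int m + 1)"
    have ext_f': "periodic_extension m n f' k = \<Phi> (?a' + k)" for k
    proof -
      have "periodic_extension m n f' k = \<phi> (orient s * (k - b)) + c * (int n + 1)"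
        using c[of "orient s * (k - b)"] by (cases s) (simp_all add: t)
      also have "\<dots> = \<Phi> ((k - b) + c * (int m + 1))"
        unfolding cyc_lift_shift[OF \<Phi>] by (simp add: \<Phi>_def)
      finally show ?thesis
        by (simp add: algebra_simps)
    qed
    have "0 \<le> \<Phi> (?a' + 0)"
      unfolding ext_f'[symmetric] using periodic_extension_int[of 0 m n f'] by simp
    moreover have "\<Phi> (?a' - 1) < 0"
    proof -
      have "f' m \<le> n"
        using f' by (auto simp: Arr_Delta)
      then have "periodic_extension m n f' (- 1) < 0"
        using cyc_lift_shift[OF cyc_lift_periodic_extension[OF f'], of "- 1" 1] periodic_extension_int[of m m n f'] by simp
      then show ?thesis
        by (simp add: ext_f')
    qed
    ultimately have a': "?a' = a"
      by (intro a_unique) simp_all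
    then have "periodic_extension m n f' k = periodic_extension m n f k" for k
      by (simp only: ext_f ext_f')
    then have "f = f'"
      using periodic_extension_inj[OF f f', of 0] by simp
    moreover have "dihedral_aut m b t = dihedral_aut m (- a) s"
    proof -
      have "b = - a + c * (int m + 1)"
        using a' by simp
      then have "b mod (int m + 1) = (- a) mod (int m + 1)"
        by (simp only: mod_mult_self1)
      then show ?thesis
        by (simp add: dihedral_aut_eq_iff t)
    qed
    ultimately show "p = ((m, f, n), dihedral_aut m (- a) s)"
      by (simp add: p)
  qed
qed

theorem proposition3p1:
  shows "(\<forall>m n f. (m, f, n) \<in> Arr Delta \<longrightarrow> (\<exists>!F. is_cyc_extension m n f F)) \<and>
    crossed_simplicial_group (\<lambda>n. dihedral_group (n + 1)) DeltaD Delta_to_DeltaD"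
proof
  show "\<forall>m n f. (m, f, n) \<in> Arr Delta \<longrightarrow> (\<exists>!F. is_cyc_extension m n f F)"
    using is_cyc_extension_cyc_ftor is_cyc_extension_unique by blast
  show "crossed_simplicial_group (\<lambda>n. dihedral_group (n + 1)) DeltaD Delta_to_DeltaD"
  proof (intro crossed_simplicial_group.intro crossed_simplicial_group_axioms.intro
      category_DeltaD cat_functor_Delta_to_DeltaD)
    show "Group.group (dihedral_group (n + 1))" for n
      by (simp add: group_dihedral_group)
    show "Obj DeltaD = UNIV"
      by (simp add: DeltaD_def)
    show "on_obj Delta_to_DeltaD n = n" for n
      by (simp add: Delta_to_DeltaD_def)
    show "inj_on (on_arr Delta_to_DeltaD) (Arr Delta)"
      by (rule inj_on_Delta_to_DeltaD)
    show "aut_group DeltaD n \<cong> opposite_group (dihedral_group (n + 1))" for n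
      by (rule aut_group_DeltaD_iso)
    show "\<exists>!(f, g). f \<in> Hom Delta m n \<and> g \<in> carrier (aut_group DeltaD m) \<and>
        h = Comp DeltaD (on_arr Delta_to_DeltaD f) g" if "h \<in> Hom DeltaD m n" for h m n
      using that by (rule dihedral_map_factorization)
  qed
qed

end
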